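(* Let $\lambda \in \mathcal{P}^{ham}(Sympeo(D^2,\partial D^2),id)$ be a topological Hamiltonian loop, i.e. a topological Hamiltonian path on the closed unit disc $D^2$ with $\lambda(0)=\lambda(1)=id$. Then $\lambda$ is contractible to the constant identity loop via a topological Hamiltonian homotopy of loops; that is, there is a hameotopy $\Lambda:[0,1]^2\to Sympeo(D^2,\partial D^2)$ with $\Lambda(0,t)=id$ and $\Lambda(1,t)=\lambda(t)$ for all $t\in[0,1]$, and $\Lambda(s,0)=\Lambda(s,1)=id$ for all $s\in[0,1]$.
   Context: $D^2\subset\mathbb{R}^2$ is the closed unit disc with area (symplectic) form $\Omega=dq\wedge dp$. A smooth Hamiltonian $H:[0,1]\times D^2\to\mathbb{R}$ with $\bigcup_t \operatorname{supp} H_t$ contained in a compact subset of $\operatorname{Int} D^2$ has Hamiltonian vector field $X_H\rfloor\Omega=dH_t$ and flow $\phi_H^t$; $\phi_H$ denotes the path $t\mapsto\phi_H^t$. $Symp(D^2,\partial D^2)=Ham(D^2,\partial D^2)$ is the group of area-preserving diffeomorphisms supported in $\operatorname{Int} D^2$; $Sympeo(D^2,\partial D^2)$ is its $C^0$-closure in the homeomorphisms. Put $\overline d(\phi,\psi)=\max\{d_{C^0}(\phi,\psi),d_{C^0}(\phi^{-1},\psi^{-1})\}$, $\overline d(\lambda,\mu)=\max_t\overline d(\lambda(t),\mu(t))$, and let the $L^{(1,\infty)}$-norm be $\|H\|=\int_0^1(\max H_t-\min H_t)\,dt$. A continuous path $\lambda:[0,1]\to Homeo(D^2)$ is a topological Hamiltonian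 path on $D^2$, written $\lambda\in\mathcal{P}^{ham}(Sympeo(D^2,\partial D^2),id)$, if there are smooth Hamiltonians $H_i$, all supported in one fixed compact subset of $\operatorname{Int} D^2$, such that $\phi_{H_i}\to\lambda$ with respect to $\overline d$ and $H_i$ is Cauchy in $L^{(1,\infty)}$. A sequence of smooth Hamiltonian paths (or their Hamiltonians) converges in Hamiltonian topology if the paths converge in $\overline d$ and the Hamiltonians are Cauchy in $L^{(1,\infty)}$. For a smooth Hamiltonian path $\mu=\phi_H$ on $D^2$, $\operatorname{Dev}(\mu):=H$ denotes its generating Hamiltonian supported in $\operatorname{Int}D^2$. Hameotopy: a map $\Lambda:[0,1]^2\to Sympeo(D^2,\partial D^2)$ with $\Lambda(0,\cdot)=\lambda_0$, $\Lambda(1,\cdot)=\lambda_1$ and $\Lambda(s,0)=id$ for all $s$ is a hameotopy between $\lambda_0$ and $\lambda_1$ if there is a sequence of smooth maps $\Lambda_j:[0,1]^2\to Ham(D^2,\partial D^2)$ such that (1) $\Lambda_j(s,0)=id$; (2) $\Lambda_j\to\Lambda$ in the $C^0$-topology; (3) writing $\Lambda_{j,s}$ for the path $t\mapsto\Lambda_j(s,t)$ and $H_j(s):=\operatorname{Dev}(\Lambda_{j,s}\Lambda_{j,0}^{-1})$, the sequence $H_j(s)$ converges in Hamiltonian topology as $j\to\infty$, uniformly over $s\in[0,1]$. *)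

theory Defs
  imports "HOL-Analysis.Analysis"
begin

section \<open>Smooth maps on arbitrary sets\<close>

primrec Ck_on :: "nat \<Rightarrow> ('a::real_normed_vector \<Rightarrow> 'b::real_normed_vector) \<Rightarrow> 'a set \<Rightarrow> bool" where
  "Ck_on 0 f U \<longleftrightarrow> continuous_on U f"
| "Ck_on (Suc k) f U \<longleftrightarrow> (\<forall>x\<in>U. f differentiable (at x)) \<and>
     (\<forall>v. Ck_on k (\<lambda>x. frechet_derivative f (at x) v) U)"

text \<open>\<open>Ck_on\<close> is meant for open sets only. On other sets (here \<open>[0,1] \<times> D\<close> etc.), smooth means
  having a smooth extension to an open neighbourhood.\<close>

definition smooth_on :: "'a::real_normed_vector set \<Rightarrow> ('a \<Rightarrow> 'b::real_normed_vector) \<Rightarrow> bool" where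
  "smooth_on S f \<longleftrightarrow>
     (\<exists>U g. open U \<and> S \<subseteq> U \<and> (\<forall>x\<in>S. g x = f x) \<and> (\<forall>k. Ck_on k g U))"


section \<open>The disc and its transformation groups\<close>

text \<open>Points of the plane are pairs \<open>(q, p)\<close>; the norm of the product type is the Euclidean one.\<close>

type_synonym plane = "real \<times> real"

definition disc :: "plane set" where
  "disc = cball 0 1"

definition Omega :: "plane \<Rightarrow> plane \<Rightarrow> real" where
  "Omega v w = fst v * snd w - snd v * fst w"

text \<open>Self-maps of the disc are total functions on the plane whose values outside \<open>disc\<close> carry no
  meaning: no definition below depends on them, and equality of maps means agreement on \<open>disc\<close>.\<close>

definition Homeo :: "(plane \<Rightarrow> plane) set" where
  "Homeo = {\<phi>. \<exists>\<psi>. homeomorphism disc disc \<phi> \<psi>}"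

definition dinv :: "(plane \<Rightarrow> plane) \<Rightarrow> plane \<Rightarrow> plane" where
  "dinv \<phi> = inv_into disc \<phi>"

definition supported_in :: "plane set \<Rightarrow> (plane \<Rightarrow> plane) \<Rightarrow> bool" where
  "supported_in K \<phi> \<longleftrightarrow> (\<forall>x\<in>disc - K. \<phi> x = x)"

text \<open>\<open>Symp(D, \<partial>D) = Ham(D, \<partial>D)\<close>. Near the boundary the maps are the identity, so \<open>\<phi>\<^sup>*\<Omega> = \<Omega>\<close>
  need only be required at interior points, where the derivative does not see the values of \<open>\<phi>\<close>
  outside the disc.\<close>

definition Symp :: "(plane \<Rightarrow> plane) set" where
  "Symp = {\<phi>. bij_betw \<phi> disc disc \<and> smooth_on disc \<phi> \<and> smooth_on disc (dinv \<phi>) \<and>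
     (\<forall>x\<in>interior disc. \<forall>v w.
        Omega (frechet_derivative \<phi> (at x) v) (frechet_derivative \<phi> (at x) w) = Omega v w) \<and>
     (\<exists>K. compact K \<and> K \<subseteq> interior disc \<and> supported_in K \<phi>)}"

definition d_C0 :: "(plane \<Rightarrow> plane) \<Rightarrow> (plane \<Rightarrow> plane) \<Rightarrow> real" where
  "d_C0 \<phi> \<psi> = (SUP x\<in>disc. dist (\<phi> x) (\<psi> x))"

definition d_bar :: "(plane \<Rightarrow> plane) \<Rightarrow> (plane \<Rightarrow> plane) \<Rightarrow> real" where
  "d_bar \<phi> \<psi> = max (d_C0 \<phi> \<psi>) (d_C0 (dinv \<phi>) (dinv \<psi>))"

definition Sympeo :: "(plane \<Rightarrow> plane) set" where
  "Sympeo = {\<phi>\<in>Homeo. \<forall>\<epsilon>>0. \<exists>\<psi>\<in>Symp. d_C0 \<psi> \<phi> < \<epsilon>}"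


section \<open>Paths\<close>

type_synonym path_on_disc = "real \<Rightarrow> plane \<Rightarrow> plane"

definition Homeo_path :: "path_on_disc \<Rightarrow> bool" where
  "Homeo_path \<gamma> \<longleftrightarrow> (\<forall>t\<in>{0..1}. \<gamma> t \<in> Homeo) \<and>
     (\<forall>t\<in>{0..1}. ((\<lambda>u. d_bar (\<gamma> u) (\<gamma> t)) \<longlongrightarrow> 0) (at t within {0..1}))"

definition d_bar_path :: "path_on_disc \<Rightarrow> path_on_disc \<Rightarrow> real" where
  "d_bar_path \<gamma> \<mu> = (SUP t\<in>{0..1}. d_bar (\<gamma> t) (\<mu> t))"

text \<open>A smooth map from a compact parameter set \<open>P\<close> into the group \<open>Ham(D, \<partial>D)\<close> of compactly supported
  diffeomorphisms: jointly smooth, with the supports in one compact subset of the interior.\<close>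

definition smooth_into_Ham :: "'p::real_normed_vector set \<Rightarrow> ('p \<Rightarrow> plane \<Rightarrow> plane) \<Rightarrow> bool" where
  "smooth_into_Ham P F \<longleftrightarrow> (\<forall>a\<in>P. F a \<in> Symp) \<and> smooth_on (P \<times> disc) (\<lambda>(a, x). F a x) \<and>
     (\<exists>K. compact K \<and> K \<subseteq> interior disc \<and> (\<forall>a\<in>P. supported_in K (F a)))"


section \<open>Hamiltonians and their flows\<close>

type_synonym hamiltonian = "real \<Rightarrow> plane \<Rightarrow> real"

text \<open>A Hamiltonian supported in the interior of the disc is extended by \<open>0\<close> to the plane.\<close>

definition smooth_hamiltonian :: "plane set \<Rightarrow> hamiltonian \<Rightarrow> bool" where
  "smooth_hamiltonian K H \<longleftrightarrow> smooth_on ({0..1} \<times> disc) (\<lambda>(t, x). H t x) \<and>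
     (\<forall>t\<in>{0..1}. \<forall>x. x \<notin> K \<longrightarrow> H t x = 0)"

definition ham_field :: "hamiltonian \<Rightarrow> real \<Rightarrow> plane \<Rightarrow> plane" where
  "ham_field H t x = (THE v. \<forall>w. Omega v w = frechet_derivative (H t) (at x) w)"

lemma ham_field_eq:
  assumes "(H t has_derivative H') (at x)"
  shows "ham_field H t x = (H' (0, 1), - H' (1, 0))"
  unfolding ham_field_def
proof (rule the_equality)
  interpret linear H'
    using assms has_derivative_linear by blast
  have fd: "frechet_derivative (H t) (at x) = H'"
    using frechet_derivative_at[OF assms] by simp
  show "\<forall>w. Omega (H' (0, 1), - H' (1, 0)) w = frechet_derivative (H t) (at x) w"
  proof
    fix w :: plane
    have "H' w = H' (fst w *\<^sub>R (1, 0) + snd w *\<^sub>R (0, 1))"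
      by simp
    also have "\<dots> = fst w * H' (1, 0) + snd w * H' (0, 1)"
      unfolding add scale by simp
    finally show "Omega (H' (0, 1), - H' (1, 0)) w = frechet_derivative (H t) (at x) w"
      by (simp add: fd Omega_def)
  qed
  fix v assume v: "\<forall>w. Omega v w = frechet_derivative (H t) (at x) w"
  from v[rule_format, of "(0, 1)"] v[rule_format, of "(1, 0)"]
  show "v = (H' (0, 1), - H' (1, 0))"
    by (auto simp: fd Omega_def prod_eq_iff)
qed

text \<open>\<open>\<phi>\<close> is the flow \<open>t \<mapsto> \<phi>\<^sub>H\<^sup>t\<close> on the disc, \<open>0 \<le> t \<le> 1\<close>, as a smooth map in \<open>(t, x)\<close>. The initial
  value problem determines \<open>\<phi>\<close> on \<open>[0,1] \<times> D\<close>.\<close>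

definition is_flow :: "hamiltonian \<Rightarrow> path_on_disc \<Rightarrow> bool" where
  "is_flow H \<phi> \<longleftrightarrow> smooth_on ({0..1} \<times> disc) (\<lambda>(t, x). \<phi> t x) \<and>
     (\<forall>x\<in>disc. \<phi> 0 x = x \<and>
        (\<forall>t\<in>{0..1}. \<phi> t x \<in> disc \<and>
           ((\<lambda>u. \<phi> u x) has_vector_derivative ham_field H t (\<phi> t x)) (at t within {0..1})))"

definition generates :: "hamiltonian \<Rightarrow> path_on_disc \<Rightarrow> bool" where
  "generates H \<phi> \<longleftrightarrow>
     (\<exists>K. compact K \<and> K \<subseteq> interior disc \<and> smooth_hamiltonian K H) \<and> is_flow H \<phi>"

definition smooth_ham_path :: "path_on_disc \<Rightarrow> bool" where
  "smooth_ham_path \<mu> \<longleftrightarrow> (\<exists>H. generates H \<mu>)"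

text \<open>The choice is immaterial: by the compact support, the generating Hamiltonian is unique for
  \<open>0 \<le> t \<le> 1\<close>.\<close>

definition Dev :: "path_on_disc \<Rightarrow> hamiltonian" where
  "Dev \<mu> = (SOME H. generates H \<mu>)"

definition osc :: "(plane \<Rightarrow> real) \<Rightarrow> real" where
  "osc h = (SUP x\<in>disc. h x) - (INF x\<in>disc. h x)"

definition L1inf :: "hamiltonian \<Rightarrow> real" where
  "L1inf H = integral {0..1} (\<lambda>t. osc (H t))"


section \<open>Topological Hamiltonian paths and hameotopies\<close>

definition topological_ham_path :: "path_on_disc \<Rightarrow> bool" where
  "topological_ham_path \<gamma> \<longleftrightarrow> Homeo_path \<gamma> \<and>
     (\<exists>K H \<Phi>. compact K \<and> K \<subseteq> interior disc \<and>
        (\<forall>i::nat. smooth_hamiltonian K (H i) \<and> is_flow (H i) (\<Phi> i)) \<and>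
        (\<lambda>i. d_bar_path (\<Phi> i) \<gamma>) \<longlonglongrightarrow> 0 \<and>
        (\<forall>\<epsilon>>0. \<exists>N. \<forall>i\<ge>N. \<forall>j\<ge>N. L1inf (\<lambda>t x. H i t x - H j t x) < \<epsilon>))"

text \<open>Convergence in Hamiltonian topology, uniformly over a parameter \<open>s \<in> S\<close>, of the smooth
  Hamiltonian paths \<open>\<Phi> j s\<close> (\<open>j \<rightarrow> \<infinity>\<close>).\<close>

definition ham_converges_uniformly_on ::
    "'s set \<Rightarrow> (nat \<Rightarrow> 's \<Rightarrow> path_on_disc) \<Rightarrow> bool" where
  "ham_converges_uniformly_on S \<Phi> \<longleftrightarrow>
     (\<forall>j. \<forall>s\<in>S. smooth_ham_path (\<Phi> j s)) \<and>
     (\<exists>\<mu>. (\<forall>s\<in>S. Homeo_path (\<mu> s)) \<and>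
        uniform_limit S (\<lambda>j s. d_bar_path (\<Phi> j s) (\<mu> s)) (\<lambda>s. 0) sequentially) \<and>
     (\<forall>\<epsilon>>0. \<exists>N. \<forall>i\<ge>N. \<forall>j\<ge>N. \<forall>s\<in>S.
        L1inf (\<lambda>t x. Dev (\<Phi> i s) t x - Dev (\<Phi> j s) t x) < \<epsilon>)"

definition hameotopy ::
    "path_on_disc \<Rightarrow> path_on_disc \<Rightarrow> (real \<Rightarrow> path_on_disc) \<Rightarrow> bool" where
  "hameotopy \<gamma>0 \<gamma>1 \<Lambda> \<longleftrightarrow>
     (\<forall>s\<in>{0..1}. \<forall>t\<in>{0..1}. \<Lambda> s t \<in> Sympeo) \<and>
     (\<forall>t\<in>{0..1}. \<forall>x\<in>disc. \<Lambda> 0 t x = \<gamma>0 t x \<and> \<Lambda> 1 t x = \<gamma>1 t x) \<and>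
     (\<forall>s\<in>{0..1}. \<forall>x\<in>disc. \<Lambda> s 0 x = x) \<and>
     (\<exists>\<Lambda>j :: nat \<Rightarrow> real \<Rightarrow> path_on_disc.
        (\<forall>j. smooth_into_Ham ({0..1} \<times> {0..1}) (\<lambda>(s, t). \<Lambda>j j s t)) \<and>
        (\<forall>j. \<forall>s\<in>{0..1}. \<forall>x\<in>disc. \<Lambda>j j s 0 x = x) \<and>
        uniform_limit ({0..1} \<times> {0..1}) (\<lambda>j (s, t). d_bar (\<Lambda>j j s t) (\<Lambda> s t)) (\<lambda>_. 0) sequentially \<and>
        ham_converges_uniformly_on {0..1} (\<lambda>j s t. \<Lambda>j j s t \<circ> dinv (\<Lambda>j j 0 t)))"

end

(* The homotopy is Alexander's isotopy: Lambda(s, t) is x |-> s gamma_t(x/s) on the disc of radius s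
   and the identity outside. It consists of loops because gamma does. If the Hamiltonians H_i generate
   Phi_i -> gamma, then the conjugated paths are generated by s^2 H_i(t, x/s); conjugation increases
   neither the uniform distances nor the L^(1,infinity)-norms, so convergence holds uniformly in s.

   Only smoothness at s = 0 fails. With e_i -> 0 put c = (s + e_i)/(1 + e_i) and b = s/(s + e_i): the
   maps x |-> c Phi_i(b t, x/c) depend smoothly on (s, t), are the identity at s = 0, and are generated
   by c^2 b H_i(b t, x/c). All rescaled quantities have the form c h(b t, x/c) with h bounded and
   continuous, which is jointly continuous in (e, s, t, x) on a compact set even where s = e = 0;
   uniform continuity gives the convergence as e -> 0. *)

theory Submission
  imports Defs
begin

section \<open>Calculus of smooth maps\<close>

text \<open>A topological Hamiltonian path supplies only Hamiltonians and their flows, whereas a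
  hameotopy asks for elements of \<open>Symp\<close>. So flows must be shown to be bijections of the
  disc that preserve area and have smooth inverses. The rescaled paths, given by explicit formulas,
  inherit all this because each is again the flow of a compactly supported Hamiltonian.
  \<open>Dev\<close> is a choice, so generating Hamiltonians must be unique before their norms can
  be compared.

  Two obstacles shape the estimates. The H_i are Cauchy only in the L^(1,infinity)-norm and have no
  common modulus of continuity, so the effect of changing e is controlled for one fixed H_n, against
  which H_i and H_j are compared. And the speed b = s/(s + e) has no limit at s = e = 0; in the
  Hamiltonian it is absorbed by one factor c, since c b = s/(1 + e), while the other factor c forces
  continuity.\<close>

lemma Ck_on_cong:
  assumes "open U" "\<And>x. x \<in> U \<Longrightarrow> f x = g x" "Ck_on k f U"
  shows "Ck_on k g U"
  using assms(2,3)
proof (induction k arbitrary: f g)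
  case 0
  then show ?case using continuous_on_cong[of U U f g] by auto
next
  case (Suc k)
  have der: "(g has_derivative frechet_derivative f (at x)) (at x)" if "x \<in> U" for x
    using Suc.prems that has_derivative_transform_within_open[of f _ x UNIV U g] assms(1)
    by (auto simp: frechet_derivative_works)
  then have "frechet_derivative g (at x) = frechet_derivative f (at x)" if "x \<in> U" for x
    using that frechet_derivative_at by metis
  then have "Ck_on k (\<lambda>x. frechet_derivative g (at x) v) U" for v
    using Suc.IH[of "\<lambda>x. frechet_derivative f (at x) v" "\<lambda>x. frechet_derivative g (at x) v"] Suc.prems
    by auto
  then show ?case using der by (auto simp: differentiable_def)
qed

text \<open>Trades the choice-based \<open>frechet_derivative\<close> for any explicit derivative
  \<open>f'\<close>, so that the usual differentiation rules drive the inductions below.\<close>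

lemma Ck_on_SucI:
  assumes "open U" "\<And>x. x \<in> U \<Longrightarrow> (f has_derivative f' x) (at x)" "\<And>v. Ck_on k (\<lambda>x. f' x v) U"
  shows "Ck_on (Suc k) f U"
proof -
  have eq: "frechet_derivative f (at x) = f' x" if "x \<in> U" for x
    using frechet_derivative_at[OF assms(2)[OF that]] by simp
  have "Ck_on k (\<lambda>x. frechet_derivative f (at x) v) U" for v
    by (rule Ck_on_cong[OF assms(1) _ assms(3)]) (simp add: eq)
  then show ?thesis using assms(2) by (auto simp: differentiable_def)
qed

lemma Ck_on_SucD:
  assumes "Ck_on (Suc k) f U" "x \<in> U"
  shows "(f has_derivative frechet_derivative f (at x)) (at x)"
  using assms by (auto simp: frechet_derivative_works)

lemma Ck_on_subset: "Ck_on k f U \<Longrightarrow> V \<subseteq> U \<Longrightarrow> Ck_on k f V"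
  by (induction k arbitrary: f) (auto intro: continuous_on_subset)

lemma Ck_on_SucD_Ck: "Ck_on (Suc k) f U \<Longrightarrow> Ck_on k f U"
proof (induction k arbitrary: f)
  case 0
  then show ?case
    by (auto intro!: differentiable_imp_continuous_on simp: differentiable_on_def differentiable_at_withinI)
qed auto

lemma Ck_on_const: "open U \<Longrightarrow> Ck_on k (\<lambda>x. c) U"
  by (induction k arbitrary: c) auto

lemma Ck_on_bounded_linear_compose:
  assumes "open U" "bounded_linear h" "Ck_on k f U"
  shows "Ck_on k (\<lambda>x. h (f x)) U"
  using assms(3)
proof (induction k arbitrary: f)
  case 0
  then show ?case
    using bounded_linear.continuous_on[OF assms(2), of U f] by simp
next
  case (Suc k)
  show ?case
    by (rule Ck_on_SucI[OF assms(1) bounded_linear.has_derivative[OF assms(2) Ck_on_SucD]])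
       (use Suc in auto)
qed

lemma Ck_on_ident: "open U \<Longrightarrow> Ck_on k (\<lambda>x. x) U"
  by (cases k) (auto intro!: Ck_on_const Ck_on_SucI)

lemma Ck_on_bounded_linear: "open U \<Longrightarrow> bounded_linear h \<Longrightarrow> Ck_on k h U"
  using Ck_on_bounded_linear_compose[OF _ _ Ck_on_ident] by blast

lemma Ck_on_add:
  assumes "open U" "Ck_on k f U" "Ck_on k g U"
  shows "Ck_on k (\<lambda>x. f x + g x) U"
  using assms(2,3)
proof (induction k arbitrary: f g)
  case 0
  then show ?case by (auto intro: continuous_on_add)
next
  case (Suc k)
  show ?case
    by (rule Ck_on_SucI[OF assms(1) has_derivative_add[OF Ck_on_SucD Ck_on_SucD]])
       (use Suc in auto)
qed

lemma Ck_on_sum: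
  assumes "open U" "finite I" "\<And>i. i \<in> I \<Longrightarrow> Ck_on k (f i) U"
  shows "Ck_on k (\<lambda>x. \<Sum>i\<in>I. f i x) U"
  using assms(2,3) by (induction I) (auto intro!: Ck_on_const Ck_on_add assms(1))

lemma (in bounded_bilinear) Ck_on:
  assumes "open U" "Ck_on k f U" "Ck_on k g U"
  shows "Ck_on k (\<lambda>x. prod (f x) (g x)) U"
  using assms(2,3)
proof (induction k arbitrary: f g)
  case 0
  then show ?case by (auto intro: continuous_on)
next
  case (Suc k)
  show ?case
    by (rule Ck_on_SucI[OF assms(1) FDERIV[OF Ck_on_SucD Ck_on_SucD]])
       (use Suc Ck_on_SucD_Ck[OF Suc.prems(1)] Ck_on_SucD_Ck[OF Suc.prems(2)]
         in \<open>auto intro!: Ck_on_add assms(1)\<close>)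
qed

lemmas Ck_on_scaleR = bounded_bilinear.Ck_on[OF bounded_bilinear_scaleR]
lemmas Ck_on_mult = bounded_bilinear.Ck_on[OF bounded_bilinear_mult]

text \<open>The chain rule gives a derivative whose direction varies with x, while the recursion of
  \<open>Ck_on\<close> treats only fixed directions. Expanding that direction in a basis leaves a
  finite sum of products to which the induction hypothesis applies; hence the Euclidean type of the
  intermediate space.\<close>

lemma Ck_on_compose:
  fixes f :: "'a::real_normed_vector \<Rightarrow> 'b::euclidean_space"
  assumes "open U" "open V" "Ck_on k g V" "Ck_on k f U" "f ` U \<subseteq> V"
  shows "Ck_on k (\<lambda>x. g (f x)) U"
  using assms(3,4)
proof (induction k arbitrary: g)
  case 0
  then show ?case using assms(5) by (auto intro: continuous_on_compose2)
next
  case (Suc k)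
  have gd: "(g has_derivative frechet_derivative g (at (f x))) (at (f x))" if "x \<in> U" for x
    by (rule Ck_on_SucD[OF Suc.prems(1)]) (use assms(5) that in auto)
  let ?D = "\<lambda>x v. frechet_derivative g (at (f x)) (frechet_derivative f (at x) v)"
  have eq: "?D x v = (\<Sum>b\<in>Basis. (frechet_derivative f (at x) v \<bullet> b) *\<^sub>R frechet_derivative g (at (f x)) b)"
    if "x \<in> U" for x v
  proof -
    interpret linear "frechet_derivative g (at (f x))"
      using gd[OF that] by (rule has_derivative_linear)
    have "?D x v = frechet_derivative g (at (f x)) (\<Sum>b\<in>Basis. (frechet_derivative f (at x) v \<bullet> b) *\<^sub>R b)"
      by (simp add: euclidean_representation)
    then show ?thesis by (simp add: sum scaleR)
  qed
  have "Ck_on k (\<lambda>x. \<Sum>b\<in>Basis. (frechet_derivative f (at x) v \<bullet> b) *\<^sub>R frechet_derivative g (at (f x)) b) U" for v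
    by (intro Ck_on_sum Ck_on_scaleR Suc.IH Ck_on_SucD_Ck[OF Suc.prems(2)] assms(1)
         Ck_on_bounded_linear_compose[of U "\<lambda>x. x \<bullet> b" for b] bounded_linear_inner_left)
       (use Suc.prems in auto)
  then have "Ck_on k (\<lambda>x. ?D x v) U" for v
    by (rule Ck_on_cong[OF assms(1), rotated]) (simp add: eq)
  then show ?case
    by (intro Ck_on_SucI[OF assms(1) has_derivative_compose[OF Ck_on_SucD[OF Suc.prems(2)] gd]])
qed

lemma Ck_on_Pair:
  assumes "open U" "Ck_on k f U" "Ck_on k g U"
  shows "Ck_on k (\<lambda>x. (f x, g x)) U"
proof -
  have "Ck_on k (\<lambda>x. (f x, 0) + (0, g x)) U"
    by (intro Ck_on_add assms Ck_on_bounded_linear_compose[where h="\<lambda>x. (x, 0)"]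
        Ck_on_bounded_linear_compose[where h="\<lambda>x. (0, x)"])
       (auto intro!: bounded_linear_Pair bounded_linear_zero bounded_linear_ident)
  then show ?thesis by simp
qed

lemma Ck_on_inverse:
  fixes f :: "'a::real_normed_vector \<Rightarrow> real"
  assumes "open U" "Ck_on k f U" "\<And>x. x \<in> U \<Longrightarrow> f x \<noteq> 0"
  shows "Ck_on k (\<lambda>x. inverse (f x)) U"
  using assms(2)
proof (induction k)
  case 0
  then show ?case using assms(3) by (auto intro: continuous_on_inverse)
next
  case (Suc k)
  show ?case
    by (rule Ck_on_SucI[OF assms(1) Deriv.has_derivative_inverse[OF assms(3) Ck_on_SucD[OF Suc.prems]]])
       (use Suc.prems Suc.IH[OF Ck_on_SucD_Ck[OF Suc.prems]]
         in \<open>auto intro!: Ck_on_mult Ck_on_bounded_linear_compose[where h="\<lambda>x. - x"]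
              bounded_linear_minus bounded_linear_ident assms(1)\<close>)
qed

section \<open>Smoothness on arbitrary sets through extensions to open neighbourhoods\<close>

lemma smooth_onI:
  assumes "open U" "S \<subseteq> U" "\<And>k. Ck_on k f U"
  shows "smooth_on S f"
  using assms unfolding smooth_on_def by blast

lemma smooth_onE:
  assumes "smooth_on S f"
  obtains U g where "open U" "S \<subseteq> U" "\<And>x. x \<in> S \<Longrightarrow> g x = f x" "\<And>k. Ck_on k g U"
  using assms unfolding smooth_on_def by blast

lemma smooth_on_openD:
  assumes "smooth_on S f" "open S"
  shows "Ck_on k f S"
  using assms by (elim smooth_onE) (blast intro: Ck_on_cong Ck_on_subset)

lemma smooth_on_subset: "smooth_on S f \<Longrightarrow> T \<subseteq> S \<Longrightarrow> smooth_on T f"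
  unfolding smooth_on_def by blast

lemma smooth_on_cong: "smooth_on S f \<Longrightarrow> (\<And>x. x \<in> S \<Longrightarrow> f x = g x) \<Longrightarrow> smooth_on S g"
  unfolding smooth_on_def by (metis (mono_tags))

lemma smooth_on_imp_continuous_on:
  assumes "smooth_on S f"
  shows "continuous_on S f"
proof -
  obtain U g where U: "open U" "S \<subseteq> U" "\<And>x. x \<in> S \<Longrightarrow> g x = f x" "\<And>k. Ck_on k g U"
    using assms by (rule smooth_onE) blast
  have "continuous_on S g" using U(4)[of 0] U(2) by (auto intro: continuous_on_subset)
  then show ?thesis using continuous_on_cong[of S S g f] U(3) by auto
qed

lemma smooth_on_const: "smooth_on S (\<lambda>x. c)"
  by (rule smooth_onI[of UNIV]) (auto intro: Ck_on_const)

lemma smooth_on_bounded_linear: "bounded_linear h \<Longrightarrow> smooth_on S h"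
  by (rule smooth_onI[of UNIV]) (auto intro: Ck_on_bounded_linear)

lemma smooth_on_bounded_linear_compose:
  assumes "bounded_linear h" "smooth_on S f"
  shows "smooth_on S (\<lambda>x. h (f x))"
  using assms(2)
proof (rule smooth_onE)
  fix U g assume U: "open U" "S \<subseteq> U" "\<And>x. x \<in> S \<Longrightarrow> g x = f x" "\<And>k. Ck_on k g U"
  have "smooth_on S (\<lambda>x. h (g x))"
    by (rule smooth_onI[OF U(1,2) Ck_on_bounded_linear_compose[OF U(1) assms(1) U(4)]])
  then show ?thesis by (rule smooth_on_cong) (simp add: U)
qed

text \<open>The two extensions live on different neighbourhoods; passing to the intersection once
  serves sums, pairs and products alike.\<close>

lemma smooth_on_binary:
  fixes f :: "'a::real_normed_vector \<Rightarrow> 'b::real_normed_vector"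
    and g :: "'a \<Rightarrow> 'c::real_normed_vector" and h :: "'b \<Rightarrow> 'c \<Rightarrow> 'd::real_normed_vector"
  assumes "\<And>(U :: 'a set) k f g. open U \<Longrightarrow> Ck_on k f U \<Longrightarrow> Ck_on k g U \<Longrightarrow> Ck_on k (\<lambda>x. h (f x) (g x)) U"
    and "smooth_on S f" "smooth_on S g"
  shows "smooth_on S (\<lambda>x. h (f x) (g x))"
proof -
  obtain U f' where U: "open U" "S \<subseteq> U" "\<And>x. x \<in> S \<Longrightarrow> f' x = f x" "\<And>k. Ck_on k f' U"
    using assms(2) by (rule smooth_onE) blast
  obtain V g' where V: "open V" "S \<subseteq> V" "\<And>x. x \<in> S \<Longrightarrow> g' x = g x" "\<And>k. Ck_on k g' V"
    using assms(3) by (rule smooth_onE) blast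
  have "Ck_on k (\<lambda>x. h (f' x) (g' x)) (U \<inter> V)" for k
    by (intro assms(1) open_Int U(1) V(1) Ck_on_subset[OF U(4)] Ck_on_subset[OF V(4)]) auto
  then have "smooth_on S (\<lambda>x. h (f' x) (g' x))"
    using U V by (intro smooth_onI[of "U \<inter> V"]) auto
  then show ?thesis by (rule smooth_on_cong) (simp add: U V)
qed

lemma smooth_on_add: "smooth_on S f \<Longrightarrow> smooth_on S g \<Longrightarrow> smooth_on S (\<lambda>x. f x + g x)"
  by (rule smooth_on_binary[where h="(+)"]) (rule Ck_on_add)

lemma smooth_on_Pair: "smooth_on S f \<Longrightarrow> smooth_on S g \<Longrightarrow> smooth_on S (\<lambda>x. (f x, g x))"
  by (rule smooth_on_binary[where h=Pair]) (rule Ck_on_Pair)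

lemma smooth_on_scaleR: "smooth_on S f \<Longrightarrow> smooth_on S g \<Longrightarrow> smooth_on S (\<lambda>x. f x *\<^sub>R g x)"
  by (rule smooth_on_binary[where h="(*\<^sub>R)"]) (rule Ck_on_scaleR)

lemma smooth_on_mult:
  fixes f g :: "'a::real_normed_vector \<Rightarrow> 'b::real_normed_algebra"
  shows "smooth_on S f \<Longrightarrow> smooth_on S g \<Longrightarrow> smooth_on S (\<lambda>x. f x * g x)"
  by (rule smooth_on_binary[where h="(*)"]) (rule Ck_on_mult)

lemma smooth_on_minus: "smooth_on S f \<Longrightarrow> smooth_on S (\<lambda>x. - f x)"
  by (rule smooth_on_bounded_linear_compose[OF bounded_linear_minus[OF bounded_linear_ident]])

lemma smooth_on_diff:
  assumes "smooth_on S f" "smooth_on S g" shows "smooth_on S (\<lambda>x. f x - g x)"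
  using smooth_on_add[OF assms(1) smooth_on_minus[OF assms(2)]] by simp

lemma smooth_on_inverse:
  fixes f :: "'a::real_normed_vector \<Rightarrow> real"
  assumes "smooth_on S f" "\<And>x. x \<in> S \<Longrightarrow> f x \<noteq> 0"
  shows "smooth_on S (\<lambda>x. inverse (f x))"
proof -
  obtain U g where U: "open U" "S \<subseteq> U" "\<And>x. x \<in> S \<Longrightarrow> g x = f x" "\<And>k. Ck_on k g U"
    using assms(1) by (rule smooth_onE) blast
  let ?V = "U \<inter> g -` (- {0})"
  have V: "open ?V"
    using U(4)[of 0] by (intro continuous_open_preimage) (auto simp: U(1))
  have "smooth_on S (\<lambda>x. inverse (g x))"
    by (rule smooth_onI[OF V]) (use assms(2) U in \<open>auto intro!: Ck_on_inverse[OF V] Ck_on_subset[OF U(4)]\<close>)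
  then show ?thesis by (rule smooth_on_cong) (simp add: U)
qed

lemma smooth_on_compose:
  fixes f :: "'a::real_normed_vector \<Rightarrow> 'b::euclidean_space"
  assumes "smooth_on T g" "smooth_on S f" "\<And>x. x \<in> S \<Longrightarrow> f x \<in> T"
  shows "smooth_on S (\<lambda>x. g (f x))"
proof -
  obtain U f' where U: "open U" "S \<subseteq> U" "\<And>x. x \<in> S \<Longrightarrow> f' x = f x" "\<And>k. Ck_on k f' U"
    using assms(2) by (rule smooth_onE) blast
  obtain V g' where V: "open V" "T \<subseteq> V" "\<And>x. x \<in> T \<Longrightarrow> g' x = g x" "\<And>k. Ck_on k g' V"
    using assms(1) by (rule smooth_onE) blast
  let ?W = "U \<inter> f' -` V"
  have W: "open ?W" using U(4)[of 0] by (intro continuous_open_preimage) (auto simp: U(1) V(1))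
  have "smooth_on S (\<lambda>x. g' (f' x))"
  proof (rule smooth_onI[OF W])
    show "S \<subseteq> ?W" by (auto simp: U(3) intro!: subsetD[OF V(2)] assms(3) subsetD[OF U(2)])
    show "Ck_on k (\<lambda>x. g' (f' x)) ?W" for k
      by (rule Ck_on_compose[OF W V(1) V(4) Ck_on_subset[OF U(4)]]) auto
  qed
  then show ?thesis by (rule smooth_on_cong) (simp add: U(3) V(3) assms(3))
qed

text \<open>T may be a closed interval, but x runs over the whole space, so the derivative of a
  slice is the derivative of any extension in the direction (0, w). This makes space derivatives of
  Hamiltonians and flows jointly smooth up to the end times.\<close>

lemma smooth_on_partial:
  fixes f :: "'a::real_normed_vector \<Rightarrow> 'b::real_normed_vector \<Rightarrow> 'c::real_normed_vector"
  assumes "smooth_on (T \<times> UNIV) (\<lambda>(t, x). f t x)"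
  shows "t \<in> T \<Longrightarrow> (f t has_derivative frechet_derivative (f t) (at x)) (at x)"
    and "smooth_on (T \<times> UNIV) (\<lambda>(t, x). frechet_derivative (f t) (at x) v)"
proof -
  obtain U g where U: "open U" "T \<times> UNIV \<subseteq> U"
    "\<And>z. z \<in> T \<times> UNIV \<Longrightarrow> g z = (\<lambda>(t, x). f t x) z" "\<And>k. Ck_on k g U"
    using assms by (rule smooth_onE) blast
  have ft: "f t = (\<lambda>x. g (t, x))" if "t \<in> T" for t using that U(3) by auto
  have der: "(f t has_derivative (\<lambda>w. frechet_derivative g (at (t, x)) (0, w))) (at x)" if "t \<in> T" for t x
    unfolding ft[OF that]
    by (rule has_derivative_compose[where f="\<lambda>x. (t, x)", OF _ Ck_on_SucD[OF U(4)]])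
       (use U(2) that in \<open>auto intro!: derivative_eq_intros\<close>)
  have fd: "frechet_derivative (f t) (at x) = (\<lambda>w. frechet_derivative g (at (t, x)) (0, w))" if "t \<in> T" for t x
    using frechet_derivative_at[OF der[OF that]] by simp
  show "(f t has_derivative frechet_derivative (f t) (at x)) (at x)" if "t \<in> T"
    using der fd that by simp
  have "smooth_on (T \<times> UNIV) (\<lambda>z. frechet_derivative g (at z) (0, v))"
  proof (rule smooth_onI[OF U(1,2)])
    show "Ck_on k (\<lambda>z. frechet_derivative g (at z) (0, v)) U" for k
      using U(4)[of "Suc k"] by simp
  qed
  then show "smooth_on (T \<times> UNIV) (\<lambda>(t, x). frechet_derivative (f t) (at x) v)"
    by (rule smooth_on_cong) (auto simp: fd)
qed

lemma Ck_on_Un: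
  assumes "open U" "open V" "Ck_on k f U" "Ck_on k f V"
  shows "Ck_on k f (U \<union> V)"
  using assms(3,4)
  by (induction k arbitrary: f) (auto intro: continuous_on_open_Un[OF assms(1,2)])

section \<open>Symmetry of second derivatives\<close>

lemma has_vector_derivative_along_line:
  assumes "(f has_derivative D) (at (a + r *\<^sub>R v))"
  shows "((\<lambda>r. f (a + r *\<^sub>R v)) has_vector_derivative D v) (at r)"
proof -
  have "((\<lambda>r. f (a + r *\<^sub>R v)) has_derivative (\<lambda>s. D (s *\<^sub>R v))) (at r)"
    by (rule has_derivative_compose[where f="\<lambda>r. a + r *\<^sub>R v", OF _ assms]) (auto intro!: derivative_eq_intros)
  then show ?thesis
    using linear_scale[OF has_derivative_linear[OF assms]] by (simp add: has_vector_derivative_def)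
qed

lemma second_derivative:
  assumes "Ck_on 2 f U" "x \<in> U"
  shows "((\<lambda>y. frechet_derivative f (at y) v) has_derivative
    frechet_derivative (\<lambda>y. frechet_derivative f (at y) v) (at x)) (at x)"
  using assms Ck_on_SucD[of 0 "\<lambda>y. frechet_derivative f (at y) v" U x] by (simp add: numeral_2_eq_2)

text \<open>The mean value theorem twice: for the increment in direction w as a function along v,
  then for the v-derivative along w. The left side is symmetric in v and w, which is what the
  symmetry proof exploits.\<close>

lemma second_difference:
  fixes f :: "'a::real_normed_vector \<Rightarrow> real"
  assumes f: "Ck_on 2 f U" and h: "0 < h"
    and U: "\<And>r s. r \<in> {0..h} \<Longrightarrow> s \<in> {0..h} \<Longrightarrow> x + r *\<^sub>R v + s *\<^sub>R w \<in> U"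
  shows "\<exists>r\<in>{0..h}. \<exists>s\<in>{0..h}.
    f (x + h *\<^sub>R v + h *\<^sub>R w) - f (x + h *\<^sub>R v) - (f (x + h *\<^sub>R w) - f x) =
    h * h * frechet_derivative (\<lambda>y. frechet_derivative f (at y) v) (at (x + r *\<^sub>R v + s *\<^sub>R w)) w"
proof -
  let ?D = "\<lambda>y. frechet_derivative f (at y) v"
  have D: "(f has_derivative frechet_derivative f (at y)) (at y)" if "y \<in> U" for y
    using f that Ck_on_SucD[of 1 f U] by (simp add: numeral_2_eq_2)
  have D2: "(?D has_derivative frechet_derivative ?D (at y)) (at y)" if "y \<in> U" for y
    by (rule second_derivative[OF f that])
  have "((\<lambda>r. f (x + h *\<^sub>R w + r *\<^sub>R v) - f (x + r *\<^sub>R v)) has_real_derivative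
      ?D (x + h *\<^sub>R w + r *\<^sub>R v) - ?D (x + r *\<^sub>R v)) (at r)" if "0 \<le> r" "r \<le> h" for r
    unfolding has_real_derivative_iff_has_vector_derivative
    by (intro has_vector_derivative_diff has_vector_derivative_along_line D)
       (use U[of r h] U[of r 0] that h in \<open>auto simp: algebra_simps\<close>)
  from MVT2[OF h this] obtain r where r: "0 < r" "r < h"
    "f (x + h *\<^sub>R w + h *\<^sub>R v) - f (x + h *\<^sub>R v) - (f (x + h *\<^sub>R w) - f x) =
     h * (?D (x + h *\<^sub>R w + r *\<^sub>R v) - ?D (x + r *\<^sub>R v))"
    by auto
  have "((\<lambda>s. ?D (x + r *\<^sub>R v + s *\<^sub>R w)) has_real_derivative
      frechet_derivative ?D (at (x + r *\<^sub>R v + s *\<^sub>R w)) w) (at s)" if "0 \<le> s" "s \<le> h" for s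
    unfolding has_real_derivative_iff_has_vector_derivative
    by (intro has_vector_derivative_along_line D2) (use U[of r s] that r in auto)
  from MVT2[OF h this] obtain s where "0 < s" "s < h"
    "?D (x + r *\<^sub>R v + h *\<^sub>R w) - ?D (x + r *\<^sub>R v) = h * frechet_derivative ?D (at (x + r *\<^sub>R v + s *\<^sub>R w)) w"
    by auto
  then show ?thesis using r by (intro bexI[of _ r] bexI[of _ s]) (auto simp: algebra_simps)
qed

text \<open>Both mixed derivatives, each at some point near x, equal the same second difference
  divided by h^2; continuity at x then identifies them.\<close>

lemma symmetric_second_derivative_real:
  fixes f :: "'a::real_normed_vector \<Rightarrow> real"
  assumes f: "Ck_on 2 f U" and U: "open U" "x \<in> U"
  shows "frechet_derivative (\<lambda>y. frechet_derivative f (at y) v) (at x) w =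
    frechet_derivative (\<lambda>y. frechet_derivative f (at y) w) (at x) v"
    (is "?P x = ?Q x")
proof -
  have cont: "continuous_on U (\<lambda>x. frechet_derivative (\<lambda>y. frechet_derivative f (at y) v) (at x) w)" for v w
    using f by (simp add: numeral_2_eq_2)
  have "dist (?P x) (?Q x) \<le> e" if "0 < e" for e
  proof -
    obtain d0 where d0: "0 < d0" "ball x d0 \<subseteq> U" using U openE by blast
    have "\<forall>\<^sub>F y in at x. dist (?P y) (?P x) < e/2" "\<forall>\<^sub>F y in at x. dist (?Q y) (?Q x) < e/2"
      using cont[of v w] cont[of w v] U half_gt_zero[OF that]
      unfolding continuous_on_eq_continuous_at[OF U(1)] isCont_def tendsto_iff by blast+
    then obtain d1 d2 where d: "0 < d1" "0 < d2"
      "\<And>y. dist y x < d1 \<Longrightarrow> y \<noteq> x \<Longrightarrow> dist (?P y) (?P x) < e/2"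
      "\<And>y. dist y x < d2 \<Longrightarrow> y \<noteq> x \<Longrightarrow> dist (?Q y) (?Q x) < e/2"
      unfolding eventually_at by blast
    define m where "m = min d0 (min d1 d2)"
    \<comment> \<open>Points of the parallelogram spanned at x have distance at most h * (norm v +
      norm w) from x; the summand 1 avoids a division by zero when v = w = 0.\<close>
    define h where "h = m / 2 / (norm v + norm w + 1)"
    have m: "0 < m" using d d0 by (simp add: m_def)
    have n: "0 < norm v + norm w + 1" by (smt (verit) norm_ge_zero)
    have h: "0 < h" using m n by (simp add: h_def)
    have hm: "h * (norm v + norm w) < m"
    proof -
      have "h * (norm v + norm w + 1) = m / 2" using n h_def nonzero_eq_divide_eq[of "norm v + norm w + 1" h "m / 2"] by auto
      then show ?thesis using h m by (simp add: algebra_simps)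
    qed
    have near: "dist (x + r *\<^sub>R v + s *\<^sub>R w) x < m" if "r \<in> {0..h}" "s \<in> {0..h}" for r s
    proof -
      have "dist (x + r *\<^sub>R v + s *\<^sub>R w) x = norm (r *\<^sub>R v + s *\<^sub>R w)"
        by (simp add: dist_norm add.assoc)
      also have "\<dots> \<le> r * norm v + s * norm w"
        using that by (intro order_trans[OF norm_triangle_ineq]) simp
      also have "\<dots> \<le> h * norm v + h * norm w"
        using that by (intro add_mono mult_right_mono) auto
      finally show ?thesis using hm by (simp add: algebra_simps)
    qed
    have inU: "x + r *\<^sub>R v + s *\<^sub>R w \<in> U" if "r \<in> {0..h}" "s \<in> {0..h}" for r s
      using near[OF that] d0 by (auto simp: m_def dist_commute)
    obtain r s where rs: "r \<in> {0..h}" "s \<in> {0..h}"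
      "f (x + h *\<^sub>R v + h *\<^sub>R w) - f (x + h *\<^sub>R v) - (f (x + h *\<^sub>R w) - f x) = h * h * ?P (x + r *\<^sub>R v + s *\<^sub>R w)"
      using second_difference[OF f h inU] by blast
    have inU': "x + r *\<^sub>R w + s *\<^sub>R v \<in> U" if "r \<in> {0..h}" "s \<in> {0..h}" for r s
      using inU[OF that(2,1)] by (simp add: algebra_simps)
    obtain r' s' where rs': "r' \<in> {0..h}" "s' \<in> {0..h}"
      "f (x + h *\<^sub>R w + h *\<^sub>R v) - f (x + h *\<^sub>R w) - (f (x + h *\<^sub>R v) - f x) = h * h * ?Q (x + r' *\<^sub>R w + s' *\<^sub>R v)"
      using second_difference[OF f h inU'] by blast
    have "h * h * ?P (x + r *\<^sub>R v + s *\<^sub>R w) = h * h * ?Q (x + s' *\<^sub>R v + r' *\<^sub>R w)"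
      using rs(3) rs'(3) by (simp add: algebra_simps)
    then have eq: "?P (x + r *\<^sub>R v + s *\<^sub>R w) = ?Q (x + s' *\<^sub>R v + r' *\<^sub>R w)"
      using h by simp
    have "dist (?P (x + r *\<^sub>R v + s *\<^sub>R w)) (?P x) \<le> e/2" "dist (?Q (x + s' *\<^sub>R v + r' *\<^sub>R w)) (?Q x) \<le> e/2"
      using near[OF rs(1,2)] near[OF rs'(2,1)] d(3)[of "x + r *\<^sub>R v + s *\<^sub>R w"] d(4)[of "x + s' *\<^sub>R v + r' *\<^sub>R w"] that
      by (fastforce simp: m_def)+
    then show ?thesis using eq dist_triangle_le[of "?P x" "?P (x + r *\<^sub>R v + s *\<^sub>R w)" "?Q x" e]
      by (simp add: dist_commute)
  qed
  then have "dist (?P x) (?Q x) \<le> 0" using field_le_epsilon[of "dist (?P x) (?Q x)" 0] by auto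
  then show ?thesis by simp
qed

text \<open>The mean value argument is real-valued, so the vector case is read off coordinate by
  coordinate.\<close>

lemma symmetric_second_derivative:
  fixes f :: "'a::real_normed_vector \<Rightarrow> 'b::euclidean_space"
  assumes f: "Ck_on 2 f U" and U: "open U" "x \<in> U"
  shows "frechet_derivative (\<lambda>y. frechet_derivative f (at y) v) (at x) w =
    frechet_derivative (\<lambda>y. frechet_derivative f (at y) w) (at x) v"
proof (rule euclidean_eqI)
  fix b :: 'b assume "b \<in> Basis"
  let ?f = "\<lambda>y. f y \<bullet> b"
  have D: "frechet_derivative ?f (at y) v = frechet_derivative f (at y) v \<bullet> b" if "y \<in> U" for y v
    using frechet_derivative_at[OF has_derivative_inner_left[OF Ck_on_SucD[of 1 f U y]]] f that
    by (simp add: numeral_2_eq_2 fun_eq_iff)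
  have D2: "frechet_derivative (\<lambda>y. frechet_derivative ?f (at y) v) (at x) w =
      frechet_derivative (\<lambda>y. frechet_derivative f (at y) v) (at x) w \<bullet> b" for v w
  proof -
    have "((\<lambda>y. frechet_derivative f (at y) v) has_derivative frechet_derivative (\<lambda>y. frechet_derivative f (at y) v) (at x)) (at x)"
      by (rule second_derivative[OF f U(2)])
    then have "((\<lambda>y. frechet_derivative f (at y) v \<bullet> b) has_derivative
        (\<lambda>w. frechet_derivative (\<lambda>y. frechet_derivative f (at y) v) (at x) w \<bullet> b)) (at x)"
      by (rule has_derivative_inner_left)
    then have "((\<lambda>y. frechet_derivative ?f (at y) v) has_derivative
        (\<lambda>w. frechet_derivative (\<lambda>y. frechet_derivative f (at y) v) (at x) w \<bullet> b)) (at x)"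
      by (rule has_derivative_transform_within_open[OF _ U]) (simp add: D)
    from frechet_derivative_at[OF this] show ?thesis by (simp add: fun_eq_iff)
  qed
  have "Ck_on 2 ?f U"
    by (rule Ck_on_bounded_linear_compose[OF U(1) bounded_linear_inner_left f])
  from symmetric_second_derivative_real[OF this U, of v w]
  show "frechet_derivative (\<lambda>y. frechet_derivative f (at y) v) (at x) w \<bullet> b =
    frechet_derivative (\<lambda>y. frechet_derivative f (at y) w) (at x) v \<bullet> b"
    by (simp only: D2)
qed

section \<open>Cut-off functions\<close>

text \<open>The factors \<open>x\<^sup>-\<^sup>n\<close> make the family closed, up to linear combinations, under differentiation,
  so that smoothness of \<open>exp (- 1 / x)\<close> at \<open>0\<close> follows by induction for all \<open>n\<close> at once.\<close>

definition flat :: "nat \<Rightarrow> real \<Rightarrow> real" where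
  "flat n x = (if 0 < x then inverse x ^ n / exp (inverse x) else 0)"

lemma flat_tendsto_0: "(flat n \<longlongrightarrow> 0) (at 0)"
  unfolding filterlim_at_split
proof
  show "(flat n \<longlongrightarrow> 0) (at_left 0)"
    by (rule tendsto_eventually) (auto simp: flat_def eventually_at_filter)
  have "((\<lambda>x. inverse x ^ n / exp (inverse x)) \<longlongrightarrow> 0) (at_right (0::real))"
    by (rule filterlim_compose[OF tendsto_power_div_exp_0 filterlim_inverse_at_top_right])
  then show "(flat n \<longlongrightarrow> 0) (at_right 0)"
    by (rule Lim_transform_eventually) (auto simp: flat_def eventually_at_filter)
qed

lemma flat_has_derivative:
  "(flat n has_real_derivative flat (n + 2) x - n * flat (n + 1) x) (at x)"
proof (cases x "0::real" rule: linorder_cases)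
  case less
  have "((\<lambda>x. 0) has_real_derivative 0) (at x)" by simp
  then have "(flat n has_real_derivative 0) (at x)"
    by (rule has_field_derivative_transform_within_open[where S="{..<0}"]) (use less in \<open>auto simp: flat_def\<close>)
  then show ?thesis using less by (simp add: flat_def)
next
  case equal
  \<comment> \<open>The difference quotient of \<open>flat n\<close> at 0 is
    \<open>flat (n + 1)\<close>, on both sides of 0 at once.\<close>
  have "((\<lambda>h. (flat n (0 + h) - flat n 0) / h) \<longlongrightarrow> 0) (at 0)"
    by (rule Lim_transform_eventually[OF flat_tendsto_0[of "n + 1"]])
       (auto simp: flat_def eventually_at_filter field_simps)
  then show ?thesis using equal by (simp add: DERIV_def flat_def)
next
  case greater
  have "((\<lambda>x. inverse x ^ n * exp (- inverse x)) has_real_derivative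
      (of_nat n * inverse x ^ (n - 1) * (- (inverse x * inverse x)) * exp (- inverse x)
       + inverse x ^ n * (exp (- inverse x) * (inverse x * inverse x)))) (at x)"
    by (rule derivative_eq_intros refl | use greater in \<open>simp\<close>)+
  \<comment> \<open>n = 0 is a case of its own because \<open>n - 1\<close> is truncated
    subtraction.\<close>
  also have "of_nat n * inverse x ^ (n - 1) * (- (inverse x * inverse x)) * exp (- inverse x)
       + inverse x ^ n * (exp (- inverse x) * (inverse x * inverse x)) = flat (n + 2) x - n * flat (n + 1) x"
    using greater by (cases n) (simp_all add: flat_def exp_minus field_simps)
  finally show ?thesis
    by (rule has_field_derivative_transform_within_open[where S="{0<..}"])
       (use greater in \<open>auto simp: flat_def exp_minus field_simps\<close>)
qed

lemma Ck_on_flat: "Ck_on k (flat n) UNIV"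
proof (induction k arbitrary: n)
  case 0
  have "isCont (flat n) x" for x
    using flat_has_derivative DERIV_isCont by blast
  then show ?case by (simp add: continuous_at_imp_continuous_on)
next
  case (Suc k)
  show ?case
  proof (rule Ck_on_SucI[OF _ flat_has_derivative[unfolded has_field_derivative_def]])
    have "Ck_on k (\<lambda>x. (flat (n + 2) x + (- n) * flat (n + 1) x) * v) UNIV" for v
      by (intro Ck_on_mult Ck_on_add Ck_on_const Suc.IH open_UNIV)
    then show "Ck_on k (\<lambda>x. (flat (n + 2) x - n * flat (n + 1) x) * v) UNIV" for v by simp
  qed simp
qed

text \<open>The quotient A / (A + B) of two flat functions: A is positive exactly where norm x < s
  and B exactly where norm x > r, so the denominator never vanishes. Squared norms keep everything
  smooth at the origin.\<close>

lemma smooth_cutoff: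
  fixes r s :: real
  assumes "0 \<le> r" "r < s"
  obtains \<beta> :: "'a::real_inner \<Rightarrow> real"
  where "\<And>k. Ck_on k \<beta> UNIV" "\<And>x. norm x \<le> r \<Longrightarrow> \<beta> x = 1" "\<And>x. s \<le> norm x \<Longrightarrow> \<beta> x = 0"
proof
  let ?A = "\<lambda>x::'a. flat 0 (s\<^sup>2 + (-1) * (x \<bullet> x))" and ?B = "\<lambda>x::'a. flat 0 (x \<bullet> x + - r\<^sup>2)"
  let ?\<beta> = "\<lambda>x. ?A x * inverse (?A x + ?B x)"
  have pos: "flat 0 x > 0 \<longleftrightarrow> x > 0" "flat 0 x \<ge> 0" for x by (auto simp: flat_def)
  have "r\<^sup>2 < s\<^sup>2" using assms by (simp add: power_strict_mono)
  then have nz: "?A x + ?B x \<noteq> 0" for x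
    using pos(1)[of "s\<^sup>2 + (-1) * (x \<bullet> x)"] pos(1)[of "x \<bullet> x + - r\<^sup>2"]
      pos(2)[of "s\<^sup>2 + (-1) * (x \<bullet> x)"] pos(2)[of "x \<bullet> x + - r\<^sup>2"] by (smt (verit))
  have inn: "Ck_on k (\<lambda>x::'a. x \<bullet> x) UNIV" for k
    by (intro bounded_bilinear.Ck_on[OF bounded_bilinear_inner] Ck_on_ident open_UNIV)
  have AB: "Ck_on k ?A UNIV" "Ck_on k ?B UNIV" for k
    by (rule Ck_on_compose[OF open_UNIV open_UNIV Ck_on_flat],
        (intro Ck_on_add Ck_on_mult Ck_on_const inn open_UNIV)[1], simp)+
  show "Ck_on k ?\<beta> UNIV" for k
    by (intro Ck_on_mult Ck_on_inverse Ck_on_add AB open_UNIV nz)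
  show "?\<beta> x = 1" if "norm x \<le> r" for x
  proof -
    have "x \<bullet> x \<le> r\<^sup>2" using that by (simp add: dot_square_norm power_mono)
    then have "?B x = 0" by (simp add: flat_def)
    then show ?thesis using nz[of x] by simp
  qed
  show "?\<beta> x = 0" if "s \<le> norm x" for x
  proof -
    have "s\<^sup>2 \<le> x \<bullet> x" using that assms by (simp add: dot_square_norm power_mono)
    then show ?thesis by (simp add: flat_def)
  qed
qed

text \<open>A concentric ball, unlike a general K, is compatible with dilations: a point outside it
  stays outside after division by c \<le> 1. This gives all rescaled Hamiltonians one common
  support.\<close>

lemma compact_subset_interior_disc:
  assumes "compact K" "K \<subseteq> interior disc"
  obtains r where "0 \<le> r" "r < 1" "K \<subseteq> cball 0 r"
proof (cases "K = {}")
  case True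
  then show ?thesis using that[of 0] by simp
next
  case False
  obtain x where x: "x \<in> K" "\<And>y. y \<in> K \<Longrightarrow> norm y \<le> norm x"
    using continuous_attains_sup[OF assms(1) False continuous_on_norm_id] by blast
  show ?thesis
  proof (rule that[of "norm x"])
    show "norm x < 1" using x(1) assms(2) by (auto simp: disc_def)
    show "K \<subseteq> cball 0 (norm x)" using x(2) mem_cball_0 by blast
  qed simp
qed

text \<open>A cut-off is unavoidable here: for parameters outside \<open>T\<close> the given smooth extension of \<open>f\<close> need
  not vanish near the boundary of the disc.\<close>

lemma smooth_on_zero_extension:
  fixes f :: "'a::real_normed_vector \<Rightarrow> plane \<Rightarrow> 'b::real_normed_vector"
  assumes f: "smooth_on (T \<times> disc) (\<lambda>(t, x). f t x)"
    and K: "compact K" "K \<subseteq> interior disc" and f0: "\<And>t x. t \<in> T \<Longrightarrow> x \<notin> K \<Longrightarrow> f t x = 0"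
  shows "smooth_on (T \<times> UNIV) (\<lambda>(t, x). f t x)"
proof -
  obtain r where r: "0 \<le> r" "r < 1" "K \<subseteq> cball 0 r" using compact_subset_interior_disc[OF K] .
  \<comment> \<open>A radius strictly between r and 1: the cut-off is 1 on the support and already 0
    near the unit circle, so its product with the extension fits together with 0.\<close>
  define s where "s = (r + 1) / 2"
  have s: "r < s" "s < 1" using r by (auto simp: s_def)
  obtain \<beta> :: "plane \<Rightarrow> real" where chi: "\<And>k. Ck_on k \<beta> UNIV"
    "\<And>x. norm x \<le> r \<Longrightarrow> \<beta> x = 1" "\<And>x. s \<le> norm x \<Longrightarrow> \<beta> x = 0"
    using smooth_cutoff[OF r(1) s(1)] by blast
  obtain U g where U: "open U" "T \<times> disc \<subseteq> U"
    "\<And>z. z \<in> T \<times> disc \<Longrightarrow> g z = (\<lambda>(t, x). f t x) z" "\<And>k. Ck_on k g U"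
    using f by (rule smooth_onE) blast
  let ?V = "{z :: 'a \<times> plane. s < norm (snd z)}"
  have V: "open ?V" by (intro open_Collect_less continuous_intros)
  define G where "G z = (if s < norm (snd z) then 0 else \<beta> (snd z) *\<^sub>R g z)" for z
  have chiU: "Ck_on k (\<lambda>z. \<beta> (snd z)) U" for k
    by (rule Ck_on_compose[OF U(1) open_UNIV chi(1)])
       (auto intro!: Ck_on_bounded_linear U(1) bounded_linear_snd)
  have "Ck_on k G U" for k
    by (rule Ck_on_cong[OF U(1) _ Ck_on_scaleR[OF U(1) chiU U(4)]]) (auto simp: G_def chi(3))
  moreover have "Ck_on k G ?V" for k
    by (rule Ck_on_cong[OF V _ Ck_on_const[OF V, of _ 0]]) (auto simp: G_def)
  ultimately have "Ck_on k G (U \<union> ?V)" for k by (rule Ck_on_Un[OF U(1) V])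
  moreover have "T \<times> UNIV \<subseteq> U \<union> ?V" using U(2) s by (force simp: disc_def)
  ultimately have "smooth_on (T \<times> UNIV) G"
    using U(1) V by (intro smooth_onI[of "U \<union> ?V"]) auto
  then show ?thesis
  proof (rule smooth_on_cong)
    fix z :: "'a \<times> plane" assume "z \<in> T \<times> UNIV"
    then obtain t x where z: "z = (t, x)" "t \<in> T" by auto
    have "f t x = 0" if "r < norm x" 
    proof -
      have "x \<notin> K" using r(3) that mem_cball_0[of x r] by (meson not_less subsetD)
      then show ?thesis by (rule f0[OF z(2)])
    qed
    then show "G z = (\<lambda>(t, x). f t x) z"
      using U(3)[of z] s chi(2)[of x] z(2)
      by (cases "norm x \<le> r") (auto simp: G_def z disc_def not_less)
  qed
qed

section \<open>Flows of compactly supported Hamiltonians\<close>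

text \<open>After t0 the function exp (- C t) * u t does not increase, before t0 the function exp (C
  t) * u t does not decrease. Both time directions matter: forwards for points off the support,
  backwards for injectivity of the flow.\<close>

lemma Gronwall_zero:
  fixes u :: "real \<Rightarrow> real"
  assumes der: "\<And>t. t \<in> {a..b} \<Longrightarrow> (u has_real_derivative u' t) (at t within {a..b})"
    and le: "\<And>t. t \<in> {a..b} \<Longrightarrow> \<bar>u' t\<bar> \<le> C * u t" and u0: "\<And>t. t \<in> {a..b} \<Longrightarrow> 0 \<le> u t"
    and t0: "t0 \<in> {a..b}" "u t0 = 0" and t: "t \<in> {a..b}"
  shows "u t = 0"
proof -
  have w: "((\<lambda>t. exp (c * t) * u t) has_derivative (\<lambda>h. (exp (c * r) * (c * u r + u' r)) * h)) (at r within {x..y})"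
    if "r \<in> {x..y}" "{x..y} \<subseteq> {a..b}" for c r x y
  proof -
    have "(u has_real_derivative u' r) (at r within {x..y})"
      by (rule DERIV_subset[OF der that(2)]) (use that in auto)
    then have "((\<lambda>t. exp (c * t) * u t) has_real_derivative exp (c * r) * (c * u r + u' r)) (at r within {x..y})"
      by (auto intro!: derivative_eq_intros simp: algebra_simps)
    then show ?thesis by (simp add: has_field_derivative_def)
  qed
  have "u t \<le> 0"
  proof (cases t t0 rule: linorder_cases)
    case less
    obtain z where z: "z \<in> {t<..<t0}"
      "exp (C * t0) * u t0 - exp (C * t) * u t = (exp (C * z) * (C * u z + u' z)) * (t0 - t)"
      using mvt_simple[OF less w[of _ t t0 C]] t t0 by auto
    have "0 \<le> C * u z + u' z" using le[of z] z(1) t t0 by auto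
    then have "0 \<le> (exp (C * z) * (C * u z + u' z)) * (t0 - t)" using less by simp
    then have "exp (C * t) * u t \<le> 0" using z(2) t0(2) by simp
    then show ?thesis by (simp add: mult_le_0_iff)
  next
    case greater
    obtain z where z: "z \<in> {t0<..<t}"
      "exp (- C * t) * u t - exp (- C * t0) * u t0 = (exp (- C * z) * (- C * u z + u' z)) * (t - t0)"
      using mvt_simple[OF greater w[of _ t0 t "- C"]] t t0 by auto
    have "- C * u z + u' z \<le> 0" using le[of z] z(1) t t0 by auto
    then have "(exp (- C * z) * (- C * u z + u' z)) * (t - t0) \<le> 0"
      using greater by (intro mult_nonpos_nonneg mult_nonneg_nonpos) auto
    then have "exp (- C * t) * u t \<le> 0" using z(2) t0(2) by simp
    then show ?thesis by (simp add: mult_le_0_iff)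
  qed (use t0 in simp)
  then show ?thesis using u0[OF t] by simp
qed

text \<open>Displacement field. Values of f off the disc are arbitrary and get replaced by 0, which
  matches f = id near the boundary; in this form a map can be extended to the plane and dilated
  without case distinctions.\<close>

definition disp :: "(plane \<Rightarrow> plane) \<Rightarrow> plane \<Rightarrow> plane" where
  "disp f x = (if x \<in> disc then f x - x else 0)"

section \<open>Smooth inverses of area-preserving maps\<close>

text \<open>Cramer's rule for determinant \<open>Omega (A (1, 0)) (A (0, 1)) = 1\<close>. The
  inverse matrix is written through \<open>Omega\<close>, without division, so its regularity
  follows from that of A.\<close>

lemma area_preserving_right_inverse:
  assumes "linear A" and Om: "\<And>v w. Omega (A v) (A w) = Omega v w"
  shows "A (Omega w (A (0, 1)), Omega (A (1, 0)) w) = w"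
proof -
  interpret linear A by fact
  obtain a c where 1: "A (1, 0) = (a, c)" by fastforce
  obtain b d where 2: "A (0, 1) = (b, d)" by fastforce
  have det: "a * d - c * b = 1" using Om[of "(1, 0)" "(0, 1)"] by (simp add: 1 2 Omega_def mult.commute)
  have "A (x, y) = (x * a + y * b, x * c + y * d)" for x y
  proof -
    have "A (x, y) = A (x *\<^sub>R (1, 0) + y *\<^sub>R (0, 1))" by simp
    also have "\<dots> = x *\<^sub>R A (1, 0) + y *\<^sub>R A (0, 1)" unfolding add scaleR by simp
    finally show ?thesis by (simp add: 1 2)
  qed
  then have "A (Omega w (A (0, 1)), Omega (A (1, 0)) w) = ((a * d - c * b) * fst w, (a * d - c * b) * snd w)"
    unfolding 1 2 Omega_def by (simp add: algebra_simps)
  then show ?thesis by (simp add: det)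
qed

lemma bounded_linear_Omega: "bounded_linear (Omega v)" "bounded_linear (\<lambda>w. Omega w v)"
  unfolding Omega_def
  by (intro bounded_linear_sub bounded_linear_const_mult bounded_linear_mult_const
      bounded_linear_fst bounded_linear_snd)+

text \<open>Bootstrapping: the derivative of g at y is the Cramer inverse of the derivative of f at
  g y, an expression in g itself, so g of class k makes its derivative of class k and g of class k +
  1.\<close>

lemma Ck_on_area_preserving_inverse:
  assumes f: "\<And>k. Ck_on k f UNIV" and gf: "\<And>x. g (f x) = x" and fg: "\<And>y. f (g y) = y"
    and Om: "\<And>x v w. Omega (frechet_derivative f (at x) v) (frechet_derivative f (at x) w) = Omega v w"
  shows "Ck_on k g UNIV"
proof -
  let ?D = "\<lambda>x. frechet_derivative f (at x)"
  let ?D' = "\<lambda>y w. (Omega w (?D (g y) (0, 1)), Omega (?D (g y) (1, 0)) w)"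
  have fD: "(f has_derivative ?D x) (at x)" for x using Ck_on_SucD[OF f, of x] by simp
  have gD': "(g has_derivative ?D' (f x)) (at (f x))" for x
  proof (rule has_derivative_inverse_strong[OF open_UNIV UNIV_I _ gf fD])
    show "continuous_on UNIV f" using f[of 0] by simp
    show "?D x \<circ> ?D' (f x) = id"
      using area_preserving_right_inverse[OF has_derivative_linear[OF fD] Om]
      by (simp add: fun_eq_iff gf)
  qed
  then have gD: "(g has_derivative ?D' y) (at y)" for y
    using gD'[of "g y"] by (simp add: fg)
  show ?thesis
  proof (induction k)
    case 0
    show ?case using has_derivative_continuous[OF gD] by (simp add: continuous_at_imp_continuous_on)
  next
    case (Suc k)
    have "Ck_on k (\<lambda>x. ?D x v) UNIV" for v using f[of "Suc k"] unfolding Ck_on.simps by blast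
    from Ck_on_compose[OF open_UNIV open_UNIV this Suc]
    have "Ck_on k (\<lambda>y. ?D (g y) v) UNIV" for v by simp
    then show ?case
      by (intro Ck_on_SucI[OF _ gD] Ck_on_Pair Ck_on_bounded_linear_compose[OF _ bounded_linear_Omega(1)]
          Ck_on_bounded_linear_compose[OF _ bounded_linear_Omega(2)]) auto
  qed
qed

section \<open>The Hamiltonian vector field and uniqueness of its integral curves\<close>

text \<open>Instantiated both by the given flows and by their rescalings, so bijectivity, area
  preservation and membership in \<open>Symp\<close> are proved once for all of them.\<close>

locale ham_flow =
  fixes K :: "plane set" and H :: hamiltonian and \<phi> :: path_on_disc
  assumes K: "compact K" "K \<subseteq> interior disc"
    and smooth_hamiltonian: "smooth_hamiltonian K H" and is_flow: "is_flow H \<phi>"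
begin

lemma K_subset_disc: "K \<subseteq> disc"
  using K(2) interior_subset by blast

lemma H_eq_0: "t \<in> {0..1} \<Longrightarrow> x \<notin> K \<Longrightarrow> H t x = 0"
  using smooth_hamiltonian unfolding smooth_hamiltonian_def by blast

text \<open>Smoothness on the whole plane is what rescaling requires, since x / c leaves the
  disc.\<close>

lemma smooth_H: "smooth_on ({0..1} \<times> UNIV) (\<lambda>(t, x). H t x)"
  using smooth_hamiltonian smooth_on_zero_extension[of "{0..1}" H K, OF _ K H_eq_0]
  by (auto simp: smooth_hamiltonian_def)

lemma ham_field: "t \<in> {0..1} \<Longrightarrow> ham_field H t x =
    (frechet_derivative (H t) (at x) (0, 1), - frechet_derivative (H t) (at x) (1, 0))"
  using smooth_on_partial(1)[OF smooth_H] by (rule ham_field_eq)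

lemma smooth_ham_field: "smooth_on ({0..1} \<times> UNIV) (\<lambda>(t, x). ham_field H t x)"
proof -
  have "smooth_on ({0..1} \<times> UNIV) (\<lambda>z. ((\<lambda>(t, x). frechet_derivative (H t) (at x) (0, 1)) z,
      - ((\<lambda>(t, x). frechet_derivative (H t) (at x) (1, 0)) z)))"
    by (intro smooth_on_Pair smooth_on_minus smooth_on_partial(2)[OF smooth_H])
  then show ?thesis by (rule smooth_on_cong) (auto simp: ham_field)
qed

lemma ham_field_eq_0:
  assumes "t \<in> {0..1}" "x \<notin> K"
  shows "ham_field H t x = 0"
proof -
  have "((\<lambda>x. 0) has_derivative (\<lambda>_. 0)) (at x)" by simp
  then have "(H t has_derivative (\<lambda>_. 0)) (at x)"
    by (rule has_derivative_transform_within_open[of _ _ x UNIV "- K"])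
       (use assms H_eq_0 K in \<open>auto intro!: compact_imp_closed\<close>)
  from ham_field_eq[of H, OF this] show ?thesis by (simp add: zero_prod_def)
qed

text \<open>Compactness bounds the derivative in the two coordinate directions, uniformly in t;
  convexity of the disc turns this into one Lipschitz constant for all times.\<close>

lemma ham_field_Lipschitz:
  obtains L where "\<And>t x y. t \<in> {0..1} \<Longrightarrow> x \<in> disc \<Longrightarrow> y \<in> disc \<Longrightarrow>
    norm (ham_field H t x - ham_field H t y) \<le> L * norm (x - y)"
proof -
  let ?D = "\<lambda>t x. frechet_derivative (ham_field H t) (at x)"
  have "\<exists>B. \<forall>t\<in>{0..1}. \<forall>x\<in>disc. norm (?D t x v) \<le> B" for v
  proof -
    have "continuous_on ({0..1} \<times> disc) (\<lambda>(t, x). ?D t x v)"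
      using smooth_on_imp_continuous_on[OF smooth_on_partial(2)[OF smooth_ham_field]]
      by (rule continuous_on_subset) auto
    then have "compact ((\<lambda>(t, x). ?D t x v) ` ({0..1} \<times> disc))"
      by (rule compact_continuous_image) (auto simp: disc_def intro!: compact_Times)
    then obtain B where B: "\<And>y. y \<in> (\<lambda>(t, x). ?D t x v) ` ({0..1} \<times> disc) \<Longrightarrow> norm y \<le> B"
      using compact_imp_bounded bounded_iff by metis
    have "norm (?D t x v) \<le> B" if "t \<in> {0..1}" "x \<in> disc" for t x
      using B[OF imageI[of "(t, x)"]] that by simp
    then show ?thesis by blast
  qed
  then obtain b where B': "\<forall>v. \<forall>t\<in>{0..1}. \<forall>x\<in>disc. norm (?D t x v) \<le> b v" by metis
  define B C where "B = b (1, 0)" and "C = b (0, 1)"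
  have B: "norm (?D t x (1, 0)) \<le> B" and C: "norm (?D t x (0, 1)) \<le> C"
    if "t \<in> {0..1}" "x \<in> disc" for t x
    using B' that unfolding B_def C_def by blast+
  show ?thesis
  proof (rule that)
    fix t :: real and x y :: plane assume t: "t \<in> {0..1}" and xy: "x \<in> disc" "y \<in> disc"
    have der: "(ham_field H t has_derivative ?D t z) (at z)" for z
      by (rule smooth_on_partial(1)[OF smooth_ham_field t])
    have "onorm (?D t z) \<le> B + C" if "z \<in> disc" for z
    proof (rule onorm_le)
      fix v :: plane
      interpret linear "?D t z" using der by (rule has_derivative_linear)
      have BC: "0 \<le> B" "0 \<le> C"
        using B[OF t that] C[OF t that] norm_ge_zero order_trans by blast+
      have "?D t z v = ?D t z (fst v *\<^sub>R (1, 0) + snd v *\<^sub>R (0, 1))" by simp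
      also have "\<dots> = fst v *\<^sub>R ?D t z (1, 0) + snd v *\<^sub>R ?D t z (0, 1)"
        unfolding add scaleR by simp
      also have "norm \<dots> \<le> norm (fst v) * norm (?D t z (1, 0)) + norm (snd v) * norm (?D t z (0, 1))"
        by (intro order_trans[OF norm_triangle_ineq]) simp
      also have "\<dots> \<le> norm v * B + norm v * C"
        using BC B[OF t that] C[OF t that] norm_fst_le[of "fst v" "snd v"] norm_snd_le[of "snd v" "fst v"]
        by (intro add_mono mult_mono) auto
      finally show "norm (?D t z v) \<le> (B + C) * norm v" by (simp add: algebra_simps)
    qed
    then show "norm (ham_field H t x - ham_field H t y) \<le> (B + C) * norm (x - y)"
      by (intro differentiable_bound[of disc _ "?D t"])
         (use xy der in \<open>auto simp: disc_def has_derivative_at_withinI\<close>)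
  qed
qed

text \<open>Gronwall for the squared distance, which is differentiable even where the curves meet.
  The common point may be at any time t0.\<close>

lemma integral_curve_unique:
  fixes y z :: "real \<Rightarrow> plane"
  assumes y: "\<And>t. t \<in> {0..1} \<Longrightarrow> y t \<in> disc"
    "\<And>t. t \<in> {0..1} \<Longrightarrow> (y has_vector_derivative ham_field H t (y t)) (at t within {0..1})"
    and z: "\<And>t. t \<in> {0..1} \<Longrightarrow> z t \<in> disc"
    "\<And>t. t \<in> {0..1} \<Longrightarrow> (z has_vector_derivative ham_field H t (z t)) (at t within {0..1})"
    and "t0 \<in> {0..1}" "y t0 = z t0" "t \<in> {0..1}"
  shows "y t = z t"
proof -
  obtain L where L: "\<And>t x y. t \<in> {0..1} \<Longrightarrow> x \<in> disc \<Longrightarrow> y \<in> disc \<Longrightarrow>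
    norm (ham_field H t x - ham_field H t y) \<le> L * norm (x - y)"
    using ham_field_Lipschitz by blast
  let ?u = "\<lambda>t. (y t - z t) \<bullet> (y t - z t)"
  let ?u' = "\<lambda>t. 2 * ((y t - z t) \<bullet> (ham_field H t (y t) - ham_field H t (z t)))"
  have "?u t = 0"
  proof (rule Gronwall_zero[where u="?u" and t=t and u'="?u'" and C="2 * L" and ?t0.0 = t0 and a=0 and b=1])
    fix t :: real assume t: "t \<in> {0..1}"
    show "(?u has_real_derivative ?u' t) (at t within {0..1})"
      unfolding has_real_derivative_iff_has_vector_derivative
      by (rule has_vector_derivative_eq_rhs[OF bounded_bilinear.has_vector_derivative[OF bounded_bilinear_inner
            has_vector_derivative_diff[OF y(2)[OF t] z(2)[OF t]]
            has_vector_derivative_diff[OF y(2)[OF t] z(2)[OF t]]]])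
         (simp add: inner_commute)
    have "\<bar>(y t - z t) \<bullet> (ham_field H t (y t) - ham_field H t (z t))\<bar>
        \<le> norm (y t - z t) * (L * norm (y t - z t))"
      by (intro order_trans[OF Cauchy_Schwarz_ineq2] mult_left_mono L t y z) simp
    then show "\<bar>?u' t\<bar> \<le> 2 * L * ?u t"
      by (simp add: abs_mult dot_square_norm power2_eq_square algebra_simps)
  qed (use assms in auto)
  then show ?thesis by simp
qed

section \<open>The flow as a bijection of the disc\<close>

lemma flow_0: "x \<in> disc \<Longrightarrow> \<phi> 0 x = x"
  and flow_in_disc: "x \<in> disc \<Longrightarrow> t \<in> {0..1} \<Longrightarrow> \<phi> t x \<in> disc"
  and flow_deriv: "x \<in> disc \<Longrightarrow> t \<in> {0..1} \<Longrightarrow>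
    ((\<lambda>u. \<phi> u x) has_vector_derivative ham_field H t (\<phi> t x)) (at t within {0..1})"
  using is_flow by (auto simp: is_flow_def)

text \<open>Where the field vanishes, the constant curve solves the same initial value
  problem.\<close>

lemma flow_outside:
  assumes "x \<in> disc" "x \<notin> K" "t \<in> {0..1}"
  shows "\<phi> t x = x"
  by (rule integral_curve_unique[where z="\<lambda>_. x" and ?t0.0 = 0])
     (use assms flow_in_disc flow_deriv flow_0 ham_field_eq_0 in auto)

lemma disp_outside: "t \<in> {0..1} \<Longrightarrow> x \<notin> K \<Longrightarrow> disp (\<phi> t) x = 0"
  by (auto simp: disp_def flow_outside)

lemma smooth_disp: "smooth_on ({0..1} \<times> UNIV) (\<lambda>(t, x). disp (\<phi> t) x)"
proof (rule smooth_on_zero_extension[OF _ K disp_outside])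
  have "smooth_on ({0..1} \<times> disc) (\<lambda>z. (\<lambda>(t, x). \<phi> t x) z - snd z)"
    using is_flow smooth_on_diff[OF _ smooth_on_bounded_linear[OF bounded_linear_snd]]
    unfolding is_flow_def by blast
  then show "smooth_on ({0..1} \<times> disc) (\<lambda>(t, x). disp (\<phi> t) x)"
    by (rule smooth_on_cong) (auto simp: disp_def)
qed

text \<open>The given path continued by the identity to the plane: derivatives and inverses can then
  be taken on an open set, whereas \<open>\<phi>\<close> is arbitrary off the disc.\<close>

definition flow :: "real \<Rightarrow> plane \<Rightarrow> plane" where
  "flow t x = x + disp (\<phi> t) x"

lemma flow_disc: "x \<in> disc \<Longrightarrow> flow t x = \<phi> t x"
  by (simp add: flow_def disp_def)

lemma flow_notin_K: "t \<in> {0..1} \<Longrightarrow> x \<notin> K \<Longrightarrow> flow t x = x"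
  by (simp add: flow_def disp_outside)

lemma smooth_flow: "smooth_on ({0..1} \<times> UNIV) (\<lambda>(t, x). flow t x)"
proof -
  have "smooth_on ({0..1} \<times> UNIV) (\<lambda>z. snd z + (\<lambda>(t, x). disp (\<phi> t) x) z)"
    by (intro smooth_on_add smooth_on_bounded_linear bounded_linear_snd smooth_disp)
  then show ?thesis by (rule smooth_on_cong) (auto simp: flow_def)
qed

lemma Ck_on_flow:
  assumes t: "t \<in> {0..1}"
  shows "Ck_on k (flow t) UNIV"
proof -
  have "smooth_on UNIV (\<lambda>x. (\<lambda>(t, x). flow t x) (t, x))"
    using t by (intro smooth_on_compose[OF smooth_flow] smooth_on_Pair smooth_on_const
        smooth_on_bounded_linear bounded_linear_ident) auto
  then show ?thesis by (intro smooth_on_openD) auto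
qed

lemma flow_zero: "flow 0 x = x"
  by (simp add: flow_def disp_def flow_0)

lemma flow_vector_derivative:
  assumes "t \<in> {0..1}"
  shows "((\<lambda>u. flow u x) has_vector_derivative ham_field H t (flow t x)) (at t within {0..1})"
proof (cases "x \<in> disc")
  case True
  then show ?thesis using flow_deriv[OF True assms] by (simp add: flow_disc)
next
  case False
  then have "flow u x = x" for u by (simp add: flow_def disp_def)
  moreover have "x \<notin> K" using False K_subset_disc by blast
  ultimately show ?thesis using ham_field_eq_0[OF assms] by simp
qed

text \<open>Two trajectories in the disc that meet at time t coincide back to time 0, by uniqueness
  started at t. Points off the disc are fixed and cannot be hit from the disc.\<close>

lemma inj_flow:
  assumes t: "t \<in> {0..1}"
  shows "inj (flow t)"
proof (rule injI)
  fix x y assume eq: "flow t x = flow t y"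
  have out: "flow t z = z" if "z \<notin> disc" for z using that by (simp add: flow_def disp_def)
  have inn: "flow t z \<in> disc" if "z \<in> disc" for z using flow_in_disc[OF that t] by (simp add: flow_disc that)
  show "x = y"
  proof (cases "x \<in> disc \<and> y \<in> disc")
    case True
    then have xy: "x \<in> disc" "y \<in> disc" by auto
    have "\<phi> 0 x = \<phi> 0 y"
      by (rule integral_curve_unique[OF flow_in_disc[OF xy(1)] flow_deriv[OF xy(1)]
            flow_in_disc[OF xy(2)] flow_deriv[OF xy(2)] t])
         (use eq xy in \<open>simp_all add: flow_disc\<close>)
    then show ?thesis using True flow_0 by auto
  next
    case False
    then show ?thesis using out inn eq by metis
  qed
qed

text \<open>By invariance of domain the range is open; it is closed since the flow moves only points of a
  compact set.\<close>

lemma flow_image: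
  assumes t: "t \<in> {0..1}"
  shows "flow t ` disc = disc" "surj (flow t)"
proof -
  have cont: "continuous_on UNIV (flow t)" using Ck_on_flow[OF t, of 0] by simp
  have opn: "open (range (flow t))"
    by (rule invariance_of_domain[OF cont open_UNIV inj_flow[OF t]])
  have "range (flow t) = flow t ` disc \<union> (- ball 0 1)"
  proof -
    have "flow t x = x" if "x \<notin> ball 0 1" for x
      using that K(2) by (intro flow_notin_K[OF t]) (auto simp: disc_def)
    moreover have "x \<in> disc" if "x \<in> ball 0 1" for x using that by (simp add: disc_def)
    ultimately show ?thesis by (auto simp: image_iff) metis+
  qed
  moreover have "compact (flow t ` disc)"
    by (rule compact_continuous_image[OF continuous_on_subset[OF cont]]) (auto simp: disc_def)
  ultimately have "closed (range (flow t))"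
    by (simp add: closed_Un compact_imp_closed closed_Compl)
  then show surj: "surj (flow t)" using opn clopen[of "range (flow t)"] by auto
  have out: "flow t z = z" if "z \<notin> disc" for z using that by (simp add: flow_def disp_def)
  show "flow t ` disc = disc"
  proof
    show "flow t ` disc \<subseteq> disc" using flow_in_disc t by (auto simp: flow_disc)
    show "disc \<subseteq> flow t ` disc"
    proof
      fix y assume y: "y \<in> disc"
      obtain x where "y = flow t x" using surj by blast
      then show "y \<in> flow t ` disc" using y out by (cases "x \<in> disc") auto
    qed
  qed
qed

lemma bij_betw_flow: "t \<in> {0..1} \<Longrightarrow> bij_betw (\<phi> t) disc disc"
  using bij_betw_cong[of disc "flow t" "\<phi> t" disc] flow_image(1)[of t] inj_on_subset[OF inj_flow[of t] subset_UNIV]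
  by (simp add: flow_disc bij_betw_def)

section \<open>Area preservation by Hamiltonian flows\<close>

text \<open>The linearised field is infinitesimally symplectic: \<open>Omega\<close> contracted with
  it is the Hessian of \<open>H t\<close>, and the Hessian is symmetric.\<close>

lemma derivative_ham_field_antisym:
  assumes t: "t \<in> {0..1}"
  shows "Omega (frechet_derivative (ham_field H t) (at x) a) b + Omega a (frechet_derivative (ham_field H t) (at x) b) = 0"
proof -
  let ?D = "\<lambda>y v. frechet_derivative (H t) (at y) v"
  let ?D2 = "\<lambda>v. frechet_derivative (\<lambda>y. ?D y v) (at x)"
  have "smooth_on UNIV (\<lambda>x. (\<lambda>(t, x). H t x) (t, x))"
    using t by (intro smooth_on_compose[OF smooth_H] smooth_on_Pair smooth_on_const
        smooth_on_bounded_linear bounded_linear_ident) auto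
  then have H: "Ck_on k (H t) UNIV" for k by (intro smooth_on_openD) auto
  have D: "((\<lambda>y. ?D y v) has_derivative ?D2 v) (at x)" for v
    by (rule second_derivative[OF H UNIV_I])
  have X: "ham_field H t = (\<lambda>y. (?D y (0, 1), - ?D y (1, 0)))"
    using ham_field[OF t] by auto
  have "(ham_field H t has_derivative (\<lambda>a. (?D2 (0, 1) a, - ?D2 (1, 0) a))) (at x)"
    unfolding X by (intro has_derivative_Pair has_derivative_minus D)
  from fun_cong[OF frechet_derivative_at[OF this]]
  have DX: "frechet_derivative (ham_field H t) (at x) a = (?D2 (0, 1) a, - ?D2 (1, 0) a)" for a
    by simp
  have D2: "?D2 b a = fst b * ?D2 (1, 0) a + snd b * ?D2 (0, 1) a" for a b
  proof -
    have "?D y b = fst b * ?D y (1, 0) + snd b * ?D y (0, 1)" for y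
    proof -
      interpret linear "?D y" using smooth_on_partial(1)[OF smooth_H t] by (rule has_derivative_linear)
      have "?D y b = ?D y (fst b *\<^sub>R (1, 0) + snd b *\<^sub>R (0, 1))" by simp
      also have "\<dots> = fst b *\<^sub>R ?D y (1, 0) + snd b *\<^sub>R ?D y (0, 1)" unfolding add scaleR by simp
      finally show ?thesis by simp
    qed
    moreover have "((\<lambda>y. fst b * ?D y (1, 0) + snd b * ?D y (0, 1)) has_derivative
        (\<lambda>a. fst b * ?D2 (1, 0) a + snd b * ?D2 (0, 1) a)) (at x)"
      by (intro has_derivative_add has_derivative_mult_right D)
    ultimately have "((\<lambda>y. ?D y b) has_derivative (\<lambda>a. fst b * ?D2 (1, 0) a + snd b * ?D2 (0, 1) a)) (at x)"
      by presburger
    from fun_cong[OF frechet_derivative_at[OF this], of a] show ?thesis by simp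
  qed
  have "?D2 b a = ?D2 a b"
    by (rule symmetric_second_derivative[OF H open_UNIV UNIV_I])
  then show ?thesis using D2[of b a] D2[of a b] by (simp add: DX Omega_def algebra_simps)
qed

text \<open>The variational equation along the flow: the mixed second derivatives of a smooth extension of the
  flow to a neighbourhood of \<open>[0,1] \<times> \<real>\<^sup>2\<close> commute.\<close>

lemma derivative_flow_vector_derivative:
  assumes t: "t \<in> {0..1}"
  shows "((\<lambda>u. frechet_derivative (flow u) (at x) v) has_vector_derivative
    frechet_derivative (ham_field H t) (at (flow t x)) (frechet_derivative (flow t) (at x) v)) (at t within {0..1})"
proof -
  obtain U g where U: "open U" "{0..1} \<times> UNIV \<subseteq> U"
    "\<And>z. z \<in> {0..1} \<times> UNIV \<Longrightarrow> g z = (\<lambda>(t, x). flow t x) z" "\<And>k. Ck_on k g U"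
    using smooth_flow by (rule smooth_onE) blast
  let ?g' = "\<lambda>v z. frechet_derivative g (at z) v"
  let ?g'' = "\<lambda>v z. frechet_derivative (?g' v) (at z)"
  have inU: "(u, y) \<in> U" if "u \<in> {0..1}" for u y using U(2) that by auto
  have g': "(g has_derivative frechet_derivative g (at z)) (at z)" if "z \<in> U" for z
    using Ck_on_SucD[OF U(4) that] .
  have g'': "(?g' v has_derivative ?g'' v z) (at z)" if "z \<in> U" for v z
    by (rule second_derivative[OF U(4) that])
  have slice: "((\<lambda>u. f (u, y)) has_vector_derivative D (1, 0)) (at u within {0..1})"
    if "(f has_derivative D) (at (u, y))" for f and D :: "real \<times> plane \<Rightarrow> plane" and u y
    using has_vector_derivative_along_line[of f D "(0, y)" u "(1, 0)"] that
    by (simp add: has_vector_derivative_at_within)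
  have flowD: "frechet_derivative (flow u) (at y) w = ?g' (0, w) (u, y)" if u: "u \<in> {0..1}" for u y w
  proof -
    have flowu: "flow u = (\<lambda>x. g (u, x))" using U(3) u by auto
    have "(flow u has_derivative (\<lambda>w. ?g' (0, w) (u, y))) (at y)"
      unfolding flowu by (rule has_derivative_compose[where f="\<lambda>x. (u, x)", OF _ g'[OF inU[OF u]]])
        (auto intro!: derivative_eq_intros)
    from fun_cong[OF frechet_derivative_at[OF this], of w] show ?thesis by simp
  qed
  \<comment> \<open>At t = 0 and t = 1 the flow equation is one-sided, whereas the extension g has a
    two-sided derivative; uniqueness of derivatives within the interval identifies them.\<close>
  have time: "?g' (1, 0) (t, y) = ham_field H t (flow t y)" for y
  proof (rule vector_derivative_unique_within)
    show "((\<lambda>u. flow u y) has_vector_derivative ham_field H t (flow t y)) (at t within {0..1})"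
      by (rule flow_vector_derivative[OF t])
    have "((\<lambda>u. g (u, y)) has_vector_derivative ?g' (1, 0) (t, y)) (at t within {0..1})"
      by (rule slice[OF g'[OF inU[OF t]]])
    then show "((\<lambda>u. flow u y) has_vector_derivative ?g' (1, 0) (t, y)) (at t within {0..1})"
      by (rule has_vector_derivative_transform[OF t, rotated]) (simp add: U(3))
    show "at t within {0..1} \<noteq> bot" using t by (simp add: trivial_limit_within)
  qed
  have flowt: "(flow t has_derivative frechet_derivative (flow t) (at x)) (at x)"
    by (rule smooth_on_partial(1)[OF smooth_flow t])
  have "((\<lambda>y. ?g' (1, 0) (t, y)) has_derivative (\<lambda>v. ?g'' (1, 0) (t, x) (0, v))) (at x)"
    by (rule has_derivative_compose[where f="\<lambda>y. (t, y)", OF _ g''[OF inU[OF t]]]) (auto intro!: derivative_eq_intros)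
  moreover have "((\<lambda>y. ?g' (1, 0) (t, y)) has_derivative
     (\<lambda>v. frechet_derivative (ham_field H t) (at (flow t x)) (frechet_derivative (flow t) (at x) v))) (at x)"
    unfolding time by (rule has_derivative_compose[OF flowt smooth_on_partial(1)[OF smooth_ham_field t]])
  ultimately have "?g'' (1, 0) (t, x) (0, v) =
      frechet_derivative (ham_field H t) (at (flow t x)) (frechet_derivative (flow t) (at x) v)"
    by (metis (no_types, lifting) has_derivative_unique)
  moreover have "?g'' (1, 0) (t, x) (0, v) = ?g'' (0, v) (t, x) (1, 0)"
    by (rule symmetric_second_derivative[OF U(4) U(1) inU[OF t]])
  moreover have "((\<lambda>u. ?g' (0, v) (u, x)) has_vector_derivative ?g'' (0, v) (t, x) (1, 0)) (at t within {0..1})"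
    by (rule slice[OF g''[OF inU[OF t]]])
  then have "((\<lambda>u. frechet_derivative (flow u) (at x) v) has_vector_derivative ?g'' (0, v) (t, x) (1, 0)) (at t within {0..1})"
    by (rule has_vector_derivative_transform[OF t, rotated]) (simp add: flowD)
  ultimately show ?thesis by simp
qed

text \<open>By the variational equation the time derivative of the left side is the antisymmetric
  expression above, hence 0; at time 0 the flow is the identity.\<close>

lemma Omega_derivative_flow:
  assumes t: "t \<in> {0..1}"
  shows "Omega (frechet_derivative (flow t) (at x) v) (frechet_derivative (flow t) (at x) w) = Omega v w"
proof -
  let ?A = "\<lambda>t v. frechet_derivative (flow t) (at x) v"
  interpret O: bounded_bilinear Omega
  proof
    show "\<exists>K. \<forall>a b. norm (Omega a b) \<le> norm a * norm b * K"
    proof (intro exI allI)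
      fix a b :: plane
      have "norm (Omega a b) \<le> norm (fst a) * norm (snd b) + norm (snd a) * norm (fst b)"
        unfolding Omega_def by (metis norm_mult norm_triangle_ineq4)
      also have "\<dots> \<le> norm a * norm b + norm a * norm b"
        using norm_fst_le[of "fst a" "snd a"] norm_snd_le[of "snd a" "fst a"]
          norm_fst_le[of "fst b" "snd b"] norm_snd_le[of "snd b" "fst b"]
        by (intro add_mono mult_mono) auto
      finally show "norm (Omega a b) \<le> norm a * norm b * 2" by simp
    qed
  qed (auto simp: Omega_def algebra_simps)
  have "((\<lambda>t. Omega (?A t v) (?A t w)) has_vector_derivative 0) (at t within {0..1})" if t: "t \<in> {0..1}" for t
    using O.has_vector_derivative[OF derivative_flow_vector_derivative[OF t, of x v] derivative_flow_vector_derivative[OF t, of x w]]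
      derivative_ham_field_antisym[OF t, of "flow t x" "?A t v" "?A t w"]
    by (simp add: add.commute)
  then obtain c where c: "\<And>t. t \<in> {0..1} \<Longrightarrow> Omega (?A t v) (?A t w) = c"
    using has_vector_derivative_zero_constant[of "{0..1::real}" "\<lambda>t. Omega (?A t v) (?A t w)"] by auto
  have "flow 0 = (\<lambda>x. x)" using flow_zero by auto
  then have "c = Omega v w" using c[of 0] by simp
  then show ?thesis using c[OF t] by simp
qed

lemma flow_Symp:
  assumes t: "t \<in> {0..1}"
  shows "\<phi> t \<in> Symp"
proof -
  \<comment> \<open>The inverse is taken on the whole plane, an open set on which
    \<open>Ck_on\<close> is meaningful; on the disc it coincides with \<open>dinv\<close>.\<close>
  let ?h = "inv (flow t)"
  have hf: "?h (flow t x) = x" for x using inj_flow[OF t] by simp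
  have fh: "flow t (?h y) = y" for y using flow_image(2)[OF t] by (simp add: surj_f_inv_f)
  have "smooth_on disc ?h"
    by (rule smooth_onI[OF open_UNIV _ Ck_on_area_preserving_inverse[OF Ck_on_flow[OF t] hf fh Omega_derivative_flow[OF t]]]) simp
  moreover have "?h y = dinv (\<phi> t) y" if y: "y \<in> disc" for y
  proof -
    obtain x where x: "x \<in> disc" "y = \<phi> t x"
      using bij_betw_flow[OF t] y unfolding bij_betw_def by blast
    then have "dinv (\<phi> t) y = x"
      using bij_betw_flow[OF t] by (simp add: dinv_def bij_betw_def)
    then show ?thesis using hf[of x] x by (simp add: flow_disc)
  qed
  ultimately have "smooth_on disc (dinv (\<phi> t))" by (rule smooth_on_cong)
  moreover have "smooth_on disc (flow t)"
    by (rule smooth_onI[OF open_UNIV _ Ck_on_flow[OF t]]) simp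
  then have "smooth_on disc (\<phi> t)" by (rule smooth_on_cong) (simp add: flow_disc)
  moreover have "frechet_derivative (\<phi> t) (at x) = frechet_derivative (flow t) (at x)" if "x \<in> interior disc" for x
  proof -
    have "(flow t has_derivative frechet_derivative (flow t) (at x)) (at x)"
      by (rule smooth_on_partial(1)[OF smooth_flow t])
    then have "(\<phi> t has_derivative frechet_derivative (flow t) (at x)) (at x)"
      by (rule has_derivative_transform_within_open[OF _ open_interior that])
         (use interior_subset flow_disc in blast)
    then show ?thesis using frechet_derivative_at by metis
  qed
  moreover have "supported_in K (\<phi> t)" using flow_outside t by (auto simp: supported_in_def)
  ultimately show ?thesis
    using bij_betw_flow[OF t] Omega_derivative_flow[OF t] K by (auto simp: Symp_def)
qed

end

section \<open>Uniform distance on maps of the disc\<close>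

lemma Homeo_bij:
  assumes "f \<in> Homeo"
  shows "bij_betw f disc disc"
proof -
  obtain g where "homeomorphism disc disc f g" using assms by (auto simp: Homeo_def)
  then show ?thesis
    using inj_on_inverseI[of disc g f] by (simp add: homeomorphism_def bij_betw_def)
qed

lemma dinv_props:
  assumes "bij_betw f disc disc"
  shows "x \<in> disc \<Longrightarrow> dinv f (f x) = x" "y \<in> disc \<Longrightarrow> f (dinv f y) = y" "y \<in> disc \<Longrightarrow> dinv f y \<in> disc"
    "x \<in> disc \<Longrightarrow> f x \<in> disc"
  using assms unfolding dinv_def bij_betw_def
  by (auto simp: f_inv_into_f inv_into_into)

lemma dinv_eqI: "bij_betw f disc disc \<Longrightarrow> x \<in> disc \<Longrightarrow> f x = y \<Longrightarrow> dinv f y = x"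
  using dinv_props(1) by blast

text \<open>\<open>inv_into\<close> consults the map only on the disc, so the two inverses are equal
  as total functions.\<close>

lemma dinv_cong: "(\<And>x. x \<in> disc \<Longrightarrow> f x = g x) \<Longrightarrow> dinv f = dinv g"
  unfolding dinv_def inv_into_def by (intro ext arg_cong[where f=Eps]) auto

lemma d_C0_cong:
  "(\<And>x. x \<in> disc \<Longrightarrow> f x = f' x) \<Longrightarrow> (\<And>x. x \<in> disc \<Longrightarrow> g x = g' x) \<Longrightarrow> d_C0 f g = d_C0 f' g'"
  unfolding d_C0_def by (intro SUP_cong) auto

lemma d_bar_cong:
  assumes "\<And>x. x \<in> disc \<Longrightarrow> f x = f' x" "\<And>x. x \<in> disc \<Longrightarrow> g x = g' x"
  shows "d_bar f g = d_bar f' g'"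
  unfolding d_bar_def using dinv_cong[OF assms(1)] dinv_cong[OF assms(2)] d_C0_cong[OF assms] by simp

lemma zero_in_disc: "0 \<in> disc"
  by (simp add: disc_def)

text \<open>The bound that makes the suprema in \<open>d_C0\<close> and \<open>d_bar_path\<close>
  meaningful; distances are therefore estimated from below only for self-maps of the disc.\<close>

lemma dist_disc_le:
  fixes x y :: plane
  assumes "x \<in> disc" "y \<in> disc"
  shows "dist x y \<le> 2"
proof -
  have "dist x y \<le> norm x + norm y" unfolding dist_norm by (rule norm_triangle_ineq4)
  then show ?thesis using assms by (simp add: disc_def)
qed

lemma d_C0_le: "(\<And>x. x \<in> disc \<Longrightarrow> dist (f x) (g x) \<le> e) \<Longrightarrow> d_C0 f g \<le> e"
  unfolding d_C0_def using zero_in_disc by (intro cSUP_least) auto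

lemma dist_le_d_C0:
  assumes "\<And>x. x \<in> disc \<Longrightarrow> f x \<in> disc" "\<And>x. x \<in> disc \<Longrightarrow> g x \<in> disc" "x \<in> disc"
  shows "dist (f x) (g x) \<le> d_C0 f g"
  unfolding d_C0_def
  by (rule cSUP_upper[OF assms(3)]) (intro bdd_aboveI2[of _ _ 2] dist_disc_le assms)

lemma d_bar_le:
  "(\<And>x. x \<in> disc \<Longrightarrow> dist (f x) (g x) \<le> e) \<Longrightarrow> (\<And>x. x \<in> disc \<Longrightarrow> dist (dinv f x) (dinv g x) \<le> e) \<Longrightarrow>
    d_bar f g \<le> e"
  unfolding d_bar_def by (simp add: d_C0_le)

lemma dist_le_d_bar:
  assumes "bij_betw f disc disc" "bij_betw g disc disc" "x \<in> disc"
  shows "dist (f x) (g x) \<le> d_bar f g" "dist (dinv f x) (dinv g x) \<le> d_bar f g"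
  using dist_le_d_C0[of f g x] dist_le_d_C0[of "dinv f" "dinv g" x] dinv_props[OF assms(1)]
    dinv_props[OF assms(2)] assms(3)
  unfolding d_bar_def by (auto simp: le_max_iff_disj)

lemma d_bar_bounds:
  assumes "bij_betw f disc disc" "bij_betw g disc disc"
  shows "0 \<le> d_bar f g" "d_bar f g \<le> 2"
  using dist_le_d_bar(1)[OF assms zero_in_disc] zero_le_dist order_trans
  by (blast, intro d_bar_le dist_disc_le) (use dinv_props[OF assms(1)] dinv_props[OF assms(2)] in auto)

lemma d_bar_triangle:
  assumes "bij_betw f disc disc" "bij_betw g disc disc" "bij_betw h disc disc"
  shows "d_bar f h \<le> d_bar f g + d_bar g h"
  using dist_le_d_bar[OF assms(1,2)] dist_le_d_bar[OF assms(2,3)]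
  by (intro d_bar_le) (meson add_mono dist_triangle order_trans)+

lemma d_bar_path_le: "(\<And>t. t \<in> {0..1} \<Longrightarrow> d_bar (\<gamma> t) (\<mu> t) \<le> e) \<Longrightarrow> d_bar_path \<gamma> \<mu> \<le> e"
  unfolding d_bar_path_def by (intro cSUP_least) auto

lemma d_bar_le_path:
  assumes "\<And>t. t \<in> {0..1} \<Longrightarrow> bij_betw (\<gamma> t) disc disc" "\<And>t. t \<in> {0..1} \<Longrightarrow> bij_betw (\<mu> t) disc disc"
    "t \<in> {0..1}"
  shows "d_bar (\<gamma> t) (\<mu> t) \<le> d_bar_path \<gamma> \<mu>"
  unfolding d_bar_path_def
  by (rule cSUP_upper[OF assms(3)]) (use assms d_bar_bounds in \<open>auto intro!: bdd_aboveI2[of _ _ 2]\<close>)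

lemma Homeo_continuous:
  assumes "f \<in> Homeo"
  shows "continuous_on disc f" "continuous_on disc (dinv f)"
proof -
  obtain g where g: "homeomorphism disc disc f g" using assms by (auto simp: Homeo_def)
  show "continuous_on disc f" using g by (simp add: homeomorphism_def)
  have "dinv f y = g y" if "y \<in> disc" for y
    using g that by (intro dinv_eqI[OF Homeo_bij[OF assms]]) (auto simp: homeomorphism_def)
  then show "continuous_on disc (dinv f)"
    using g continuous_on_cong[of disc disc "dinv f" g] by (simp add: homeomorphism_def)
qed

section \<open>Rescaling\<close>

text \<open>Alexander's conjugation \<open>x \<mapsto> c f(x/c)\<close> on the disc of radius \<open>c\<close>, extended by the identity. Because
  of \<open>inverse 0 = 0\<close> the formula in terms of the displacement also covers \<open>c = 0\<close>, where it gives the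
  identity.\<close>

definition resc :: "real \<Rightarrow> (plane \<Rightarrow> plane) \<Rightarrow> plane \<Rightarrow> plane" where
  "resc c f x = x + c *\<^sub>R disp f (x /\<^sub>R c)"

text \<open>Pasting along the unit circle, where the displacement of a map fixing the boundary
  vanishes.\<close>

lemma continuous_on_disp:
  assumes "continuous_on disc f" and "\<And>x. norm x = 1 \<Longrightarrow> f x = x"
  shows "continuous_on UNIV (disp f)"
proof -
  have "continuous_on disc (\<lambda>x. f x - x)" by (intro continuous_intros assms)
  then have 1: "continuous_on disc (disp f)"
    using continuous_on_cong[of disc disc "disp f"] by (simp add: disp_def)
  have "disp f x = 0" if "x \<in> - ball 0 1" for x
    using that assms(2)[of x] by (auto simp: disp_def disc_def)
  then have 2: "continuous_on (- ball 0 1) (disp f)"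
    using continuous_on_cong[of "- ball 0 1" "- ball 0 1" "disp f" "\<lambda>_. 0"] by simp
  have "disc \<union> - ball 0 1 = UNIV" by (auto simp: disc_def)
  then show ?thesis
    using continuous_on_closed_Un[OF _ _ 1 2] by (simp add: closed_Compl disc_def)
qed

lemma norm_disp_le:
  assumes "\<And>x. x \<in> disc \<Longrightarrow> f x \<in> disc"
  shows "norm (disp f x) \<le> 2"
  using assms dist_disc_le[of "f x" x] by (simp add: disp_def dist_norm)

lemma dist_disp_le:
  assumes "\<And>x. x \<in> disc \<Longrightarrow> dist (f x) (g x) \<le> e" "0 \<le> e"
  shows "dist (disp f x) (disp g x) \<le> e"
  using assms by (simp add: disp_def dist_norm)

lemma resc_zero [simp]: "resc 0 f x = x"
  by (simp add: resc_def)

lemma scaled_in_disc: "0 < c \<Longrightarrow> x /\<^sub>R c \<in> disc \<longleftrightarrow> norm x \<le> c"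
  by (simp add: disc_def field_simps)

lemma resc_inside: "0 < c \<Longrightarrow> norm x \<le> c \<Longrightarrow> resc c f x = c *\<^sub>R f (x /\<^sub>R c)"
  by (simp add: resc_def disp_def scaled_in_disc scaleR_diff_right)

lemma resc_outside: "0 \<le> c \<Longrightarrow> c < norm x \<Longrightarrow> resc c f x = x"
  using scaled_in_disc[of c x] by (cases "c = 0") (auto simp: resc_def disp_def)

lemma resc_one: "x \<in> disc \<Longrightarrow> resc 1 f x = f x"
  by (simp add: resc_def disp_def)

lemma norm_resc_inside:
  assumes "\<And>x. x \<in> disc \<Longrightarrow> f x \<in> disc" "0 < c" "norm x \<le> c"
  shows "norm (resc c f x) \<le> c"
proof -
  have "norm (f (x /\<^sub>R c)) \<le> 1"
    using assms(1)[of "x /\<^sub>R c"] scaled_in_disc[OF assms(2)] assms(3) by (auto simp: disc_def)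
  then show ?thesis using assms by (simp add: resc_inside mult_left_le)
qed

lemma resc_in_disc:
  assumes "\<And>x. x \<in> disc \<Longrightarrow> f x \<in> disc" "c \<in> {0..1}" "x \<in> disc"
  shows "resc c f x \<in> disc"
proof (cases "0 < c \<and> norm x \<le> c")
  case True
  then show ?thesis using norm_resc_inside[of f c x, OF assms(1)] assms(2) by (simp add: disc_def)
next
  case False
  then show ?thesis using assms resc_outside[of c x f] by (cases "c = 0") auto
qed

text \<open>Stated for a one-sided inverse so that it can be applied to a map and its inverse in
  either order.\<close>

lemma resc_resc:
  assumes "\<And>x. x \<in> disc \<Longrightarrow> g x \<in> disc" "\<And>x. x \<in> disc \<Longrightarrow> f (g x) = x" "0 \<le> c"
  shows "resc c f (resc c g x) = x"
proof (cases "0 < c \<and> norm x \<le> c")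
  case True
  then have "norm (resc c g x) \<le> c" using norm_resc_inside[of g c x, OF assms(1)] by blast
  moreover have "x /\<^sub>R c \<in> disc" using True scaled_in_disc by blast
  ultimately show ?thesis using True assms(2) by (simp add: resc_inside)
next
  case False
  then show ?thesis using assms(3) resc_outside[of c x] by (cases "c = 0") auto
qed

lemma dist_resc_le:
  assumes "\<And>x. x \<in> disc \<Longrightarrow> dist (f x) (g x) \<le> e" "0 \<le> e" "c \<in> {0..1}"
  shows "dist (resc c f x) (resc c g x) \<le> e"
proof -
  have "dist (resc c f x) (resc c g x) = c * dist (disp f (x /\<^sub>R c)) (disp g (x /\<^sub>R c))"
    using assms(3) by (simp add: resc_def dist_norm flip: scaleR_diff_right)
  also have "\<dots> \<le> 1 * e"
    using assms by (intro mult_mono dist_disp_le) auto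
  finally show ?thesis by simp
qed

lemma resc_bij:
  assumes f: "bij_betw f disc disc" and c: "c \<in> {0..1}"
  shows "bij_betw (resc c f) disc disc"
  using dinv_props[OF f] c
  by (intro bij_betw_byWitness[where f'="resc c (dinv f)"]) (auto intro!: resc_resc resc_in_disc)

text \<open>Conjugation commutes with inversion, so both halves of \<open>d_bar\<close> obey the
  same estimates.\<close>

lemma dinv_resc:
  assumes f: "bij_betw f disc disc" and c: "c \<in> {0..1}" and "y \<in> disc"
  shows "dinv (resc c f) y = resc c (dinv f) y"
  using dinv_props[OF f] assms
  by (intro dinv_eqI[OF resc_bij[OF f c]]) (auto intro!: resc_resc resc_in_disc)

lemma d_bar_resc_le:
  assumes f: "bij_betw f disc disc" and g: "bij_betw g disc disc" and c: "c \<in> {0..1}"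
  shows "d_bar (resc c f) (resc c g) \<le> d_bar f g"
  using dist_le_d_bar[OF f g] d_bar_bounds[OF f g] c
  by (intro d_bar_le) (auto simp: dinv_resc f g intro!: dist_resc_le)

lemma continuous_on_resc:
  assumes "continuous_on disc f" and "\<And>x. norm x = 1 \<Longrightarrow> f x = x"
  shows "continuous_on S (resc c f)"
proof -
  have "continuous_on S (\<lambda>x. disp f (x /\<^sub>R c))"
    by (rule continuous_on_compose2[OF continuous_on_disp[OF assms]]) (auto intro!: continuous_intros)
  then show ?thesis unfolding resc_def by (intro continuous_intros)
qed

lemma dinv_boundary:
  assumes "bij_betw f disc disc" "\<And>x. norm x = 1 \<Longrightarrow> f x = x" "norm x = 1"
  shows "dinv f x = x"
  using assms by (intro dinv_eqI) (auto simp: disc_def)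

lemma resc_Homeo:
  assumes f: "f \<in> Homeo" "\<And>x. norm x = 1 \<Longrightarrow> f x = x" and c: "c \<in> {0..1}"
  shows "resc c f \<in> Homeo"
proof -
  have b: "bij_betw f disc disc" by (rule Homeo_bij[OF f(1)])
  have "homeomorphism disc disc (resc c f) (resc c (dinv f))"
  proof (rule homeomorphismI)
    show "continuous_on disc (resc c f)" "continuous_on disc (resc c (dinv f))"
      using f Homeo_continuous[OF f(1)] dinv_boundary[OF b] by (auto intro!: continuous_on_resc)
  qed (use dinv_props[OF b] c in \<open>auto intro!: resc_resc resc_in_disc\<close>)
  then show ?thesis by (auto simp: Homeo_def)
qed

section \<open>Uniform convergence of rescaled families\<close>

text \<open>The family \<open>s \<mapsto> resc s\<close> is not smooth at \<open>s = 0\<close>. It is approximated by scales bounded away from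
  \<open>0\<close> for \<open>\<epsilon> > 0\<close>, together with a slowed-down time which makes the path at \<open>s = 0\<close> exactly constant,
  so that its inverse drops out of the third condition on a hameotopy. The speed tends to \<open>1\<close> only
  pointwise in \<open>s > 0\<close>, but where it is not close to \<open>1\<close> the scale is small.\<close>

definition scale_of :: "real \<Rightarrow> real \<Rightarrow> real" where
  "scale_of \<epsilon> s = (s + \<epsilon>) / (1 + \<epsilon>)"

definition speed_of :: "real \<Rightarrow> real \<Rightarrow> real" where
  "speed_of \<epsilon> s = s / (s + \<epsilon>)"

lemma scale_of_in: "\<epsilon> \<in> {0..1} \<Longrightarrow> s \<in> {0..1} \<Longrightarrow> scale_of \<epsilon> s \<in> {0..1}"
  by (auto simp: scale_of_def divide_le_eq_1)

lemma speed_of_in: "\<epsilon> \<in> {0..1} \<Longrightarrow> s \<in> {0..1} \<Longrightarrow> speed_of \<epsilon> s \<in> {0..1}"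
  by (auto simp: speed_of_def divide_le_eq_1)

lemma scale_of_pos: "0 < \<epsilon> \<Longrightarrow> 0 \<le> s \<Longrightarrow> 0 < scale_of \<epsilon> s"
  by (simp add: scale_of_def)

lemma speed_of_mult_in: "\<epsilon> \<in> {0..1} \<Longrightarrow> s \<in> {0..1} \<Longrightarrow> t \<in> {0..1} \<Longrightarrow> speed_of \<epsilon> s * t \<in> {0..1}"
  using speed_of_in[of \<epsilon> s] by (auto intro: mult_le_one)

lemma scale_zero [simp]: "scale_of 0 s = s"
  by (simp add: scale_of_def)

text \<open>Where \<epsilon> + s > 0, an open condition, this is a composition of continuous maps.
  At \<epsilon> = s = 0 the arguments of h need not converge, but h is bounded by M and its factor
  \<open>scale_of \<epsilon> s\<close> tends to 0.\<close>

lemma continuous_on_rescaled: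
  fixes h :: "real \<times> plane \<Rightarrow> 'a::real_normed_vector"
  assumes h: "continuous_on ({0..1} \<times> UNIV) h" and M: "\<And>z. z \<in> {0..1} \<times> UNIV \<Longrightarrow> norm (h z) \<le> M"
  shows "continuous_on ({0..1} \<times> {0..1} \<times> {0..1} \<times> UNIV)
    (\<lambda>(\<epsilon>, s, t, x). scale_of \<epsilon> s *\<^sub>R h (speed_of \<epsilon> s * t, x /\<^sub>R scale_of \<epsilon> s))"
    (is "continuous_on ?S ?F")
proof -
  let ?P = "{z :: real \<times> real \<times> real \<times> plane. 0 < fst z + fst (snd z)}"
  have P: "open ?P" by (intro open_Collect_less continuous_intros)
  have sc: "continuous_on ?S (\<lambda>z. scale_of (fst z) (fst (snd z)))"
    unfolding scale_of_def by (intro continuous_intros) auto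
  have onP: "continuous_on (?S \<inter> ?P) ?F"
  proof -
    have "continuous_on (?S \<inter> ?P) (\<lambda>z. scale_of (fst z) (fst (snd z)) *\<^sub>R
        h (speed_of (fst z) (fst (snd z)) * fst (snd (snd z)), snd (snd (snd z)) /\<^sub>R scale_of (fst z) (fst (snd z))))"
    proof (intro continuous_on_scaleR continuous_on_compose2[OF h])
      show "continuous_on (?S \<inter> ?P) (\<lambda>z. scale_of (fst z) (fst (snd z)))"
        by (rule continuous_on_subset[OF sc]) auto
      show "continuous_on (?S \<inter> ?P) (\<lambda>z. (speed_of (fst z) (fst (snd z)) * fst (snd (snd z)),
          snd (snd (snd z)) /\<^sub>R scale_of (fst z) (fst (snd z))))"
        unfolding speed_of_def scale_of_def by (intro continuous_intros) auto
    qed (auto intro!: speed_of_mult_in[unfolded atLeastAtMost_iff, THEN conjunct1]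
          speed_of_mult_in[unfolded atLeastAtMost_iff, THEN conjunct2])
    then show ?thesis by (simp add: case_prod_unfold)
  qed
  show ?thesis
    unfolding continuous_on_eq_continuous_within
  proof
    fix z assume z: "z \<in> ?S"
    show "continuous (at z within ?S) ?F"
    proof (cases "z \<in> ?P")
      case True
      then have "continuous (at z within (?S \<inter> ?P)) ?F"
        using onP z by (simp add: continuous_on_eq_continuous_within)
      moreover have "at z within (?S \<inter> ?P) = at z within ?S"
        by (rule at_within_nhd[OF True P]) auto
      ultimately show ?thesis by simp
    next
      case False
      then have z0: "scale_of (fst z) (fst (snd z)) = 0" using z by (auto simp: scale_of_def)
      then have F0: "?F z = 0" by (simp add: case_prod_unfold)
      have "((\<lambda>z. scale_of (fst z) (fst (snd z))) \<longlongrightarrow> scale_of (fst z) (fst (snd z))) (at z within ?S)"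
        using sc z unfolding continuous_on_def by blast
      then have "((\<lambda>z. scale_of (fst z) (fst (snd z))) \<longlongrightarrow> 0) (at z within ?S)"
        by (simp only: z0)
      then have "((\<lambda>z. scale_of (fst z) (fst (snd z)) * M) \<longlongrightarrow> 0) (at z within ?S)"
        by (rule tendsto_mult_left_zero)
      then have "(?F \<longlongrightarrow> 0) (at z within ?S)"
      proof (rule Lim_null_comparison[rotated], unfold eventually_at_filter, intro always_eventually allI impI)
        fix w :: "real \<times> real \<times> real \<times> plane" assume "w \<in> ?S"
        then obtain \<epsilon> s t x where w: "w = (\<epsilon>, s, t, x)" "\<epsilon> \<in> {0..1}" "s \<in> {0..1}" "t \<in> {0..1}" by auto
        have "norm (?F w) = scale_of \<epsilon> s * norm (h (speed_of \<epsilon> s * t, x /\<^sub>R scale_of \<epsilon> s))"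
          using scale_of_in[OF w(2,3)] by (simp add: w(1))
        also have "\<dots> \<le> scale_of \<epsilon> s * M"
          using scale_of_in[OF w(2,3)] speed_of_mult_in[OF w(2-4)] by (intro mult_left_mono M) auto
        finally show "norm (?F w) \<le> scale_of (fst w) (fst (snd w)) * M" by (simp add: w(1))
      qed
      then show ?thesis by (simp only: continuous_within F0)
    qed
  qed
qed

lemma uniform_at_zero:
  fixes G :: "real \<times> 'a::metric_space \<Rightarrow> 'b::metric_space"
  assumes "continuous_on ({0..1} \<times> Q) G" "compact Q" "0 < e"
  obtains d where "0 < d" "\<And>\<epsilon> q. \<epsilon> \<in> {0..1} \<Longrightarrow> \<epsilon> < d \<Longrightarrow> q \<in> Q \<Longrightarrow> dist (G (\<epsilon>, q)) (G (0, q)) < e"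
proof -
  have "uniformly_continuous_on ({0..1} \<times> Q) G"
    using assms by (intro compact_uniformly_continuous compact_Times) auto
  then obtain d where d: "0 < d"
    "\<forall>z\<in>{0..1}\<times>Q. \<forall>w\<in>{0..1}\<times>Q. dist w z < d \<longrightarrow> dist (G w) (G z) < e"
    using assms(3) unfolding uniformly_continuous_on_def by blast
  show ?thesis
  proof (rule that[OF d(1)])
    fix \<epsilon> q assume "\<epsilon> \<in> {0..1}" "\<epsilon> < d" "q \<in> Q"
    then show "dist (G (\<epsilon>, q)) (G (0, q)) < e"
      by (intro d(2)[rule_format]) (auto simp: dist_Pair_Pair)
  qed
qed

text \<open>Triangle inequality through \<open>h t y'\<close>: uniformity in y pays for the change
  of t, continuity of the single map \<open>h t\<close> for the change of y.\<close>

lemma continuous_on_uniform_family: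
  fixes h :: "'t::metric_space \<Rightarrow> 'a::metric_space \<Rightarrow> 'b::metric_space"
  assumes h: "\<And>t. t \<in> T \<Longrightarrow> continuous_on UNIV (h t)"
    and u: "\<And>t e. t \<in> T \<Longrightarrow> 0 < e \<Longrightarrow> \<forall>\<^sub>F u in at t within T. \<forall>y. dist (h u y) (h t y) < e"
  shows "continuous_on (T \<times> UNIV) (\<lambda>(t, y). h t y)"
  unfolding continuous_on_iff
proof (intro ballI allI impI)
  fix z :: "'t \<times> 'a" and e :: real assume z: "z \<in> T \<times> UNIV" and e: "0 < e"
  obtain t y where ty: "z = (t, y)" "t \<in> T" using z by auto
  obtain d1 where d1: "0 < d1" "\<And>u y. u \<in> T \<Longrightarrow> u \<noteq> t \<Longrightarrow> dist u t < d1 \<Longrightarrow> dist (h u y) (h t y) < e/2"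
    using u[OF ty(2) half_gt_zero[OF e]] unfolding eventually_at by blast
  obtain d2 where d2: "0 < d2" "\<And>y'. dist y' y < d2 \<Longrightarrow> dist (h t y') (h t y) < e/2"
    using h[OF ty(2)] half_gt_zero[OF e] unfolding continuous_on_iff by blast
  show "\<exists>d>0. \<forall>w\<in>T \<times> UNIV. dist w z < d \<longrightarrow> dist ((\<lambda>(t, y). h t y) w) ((\<lambda>(t, y). h t y) z) < e"
  proof (intro exI[of _ "min d1 d2"] conjI ballI impI)
    fix w :: "'t \<times> 'a" assume w: "w \<in> T \<times> UNIV" "dist w z < min d1 d2"
    obtain u y' where uy: "w = (u, y')" "u \<in> T" using w by auto
    have "dist u t < d1" "dist y' y < d2"
      using w(2) dist_fst_le[of w z] dist_snd_le[of w z] by (auto simp: uy ty)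
    then have "dist (h u y') (h t y') < e/2" "dist (h t y') (h t y) < e/2"
      using d1(2)[OF uy(2), of y'] d2(2) e by (cases "u = t"; simp)+
    then show "dist ((\<lambda>(t, y). h t y) w) ((\<lambda>(t, y). h t y) z) < e"
      using dist_triangle_half_l[of "h u y'" "h t y'" e "h t y"] by (simp add: uy ty dist_commute)
  qed (use d1 d2 in auto)
qed

text \<open>The modulus d is left abstract because \<open>d_bar\<close> will dominate both the path
  and the path of inverses.\<close>

lemma continuous_on_disp_family:
  fixes \<gamma> :: path_on_disc
  assumes \<gamma>: "\<And>t. t \<in> {0..1} \<Longrightarrow> continuous_on disc (\<gamma> t)" "\<And>t x. t \<in> {0..1} \<Longrightarrow> norm x = 1 \<Longrightarrow> \<gamma> t x = x"
    and d: "\<And>t. t \<in> {0..1} \<Longrightarrow> (d t \<longlongrightarrow> 0) (at t within {0..1})"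
      "\<And>t u x. t \<in> {0..1} \<Longrightarrow> u \<in> {0..1} \<Longrightarrow> x \<in> disc \<Longrightarrow> dist (\<gamma> u x) (\<gamma> t x) \<le> d t u"
  shows "continuous_on ({0..1} \<times> UNIV) (\<lambda>(t, y). disp (\<gamma> t) y)"
proof (rule continuous_on_uniform_family[of "{0..1}" "\<lambda>t. disp (\<gamma> t)"])
  show "continuous_on UNIV (disp (\<gamma> t))" if "t \<in> {0..1}" for t
    using that by (intro continuous_on_disp \<gamma>)
  show "\<forall>\<^sub>F u in at t within {0..1}. \<forall>y. dist (disp (\<gamma> u) y) (disp (\<gamma> t) y) < e"
    if t: "t \<in> {0..1}" and e: "0 < e" for t e
  proof -
    have "\<forall>\<^sub>F u in at t within {0..1}. dist (d t u) 0 < e" using d(1)[OF t] e by (auto simp: tendsto_iff)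
    moreover have "\<forall>\<^sub>F u in at t within {0..1}. u \<in> {0..1}" by (auto simp: eventually_at_filter)
    ultimately show ?thesis
    proof eventually_elim
      case (elim u)
      have "0 \<le> d t u" using d(2)[OF t elim(2) zero_in_disc] zero_le_dist order_trans by blast
      then have "dist (disp (\<gamma> u) y) (disp (\<gamma> t) y) \<le> d t u" for y
        using d(2)[OF t elim(2)] by (intro dist_disp_le)
      moreover have "d t u < e" using elim(1) by simp
      ultimately show ?case using le_less_trans by blast
    qed
  qed
qed

lemma rescaled_path_converges:
  assumes \<gamma>: "Homeo_path \<gamma>" "\<And>t x. t \<in> {0..1} \<Longrightarrow> norm x = 1 \<Longrightarrow> \<gamma> t x = x" and e: "0 < e"
  obtains d where "0 < d" "\<And>\<epsilon> s t. \<epsilon> \<in> {0..1} \<Longrightarrow> \<epsilon> < d \<Longrightarrow> s \<in> {0..1} \<Longrightarrow> t \<in> {0..1} \<Longrightarrow>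
    d_bar (resc (scale_of \<epsilon> s) (\<gamma> (speed_of \<epsilon> s * t))) (resc s (\<gamma> t)) \<le> e"
proof -
  have H: "\<gamma> t \<in> Homeo" if "t \<in> {0..1}" for t using \<gamma>(1) that by (simp add: Homeo_path_def)
  have b: "bij_betw (\<gamma> t) disc disc" if "t \<in> {0..1}" for t using Homeo_bij H that by blast
  \<comment> \<open>Formulated for a general \<mu>, to be used for \<gamma> and for its
    inverses.\<close>
  have conv: "\<exists>d>0. \<forall>\<epsilon>\<in>{0..1}. \<epsilon> < d \<longrightarrow> (\<forall>s\<in>{0..1}. \<forall>t\<in>{0..1}. \<forall>x\<in>disc.
      dist (resc (scale_of \<epsilon> s) (\<mu> (speed_of \<epsilon> s * t)) x) (resc s (\<mu> t) x) < e)"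
    if "continuous_on ({0..1} \<times> UNIV) (\<lambda>(t, y). disp (\<mu> t) y)"
      "\<And>t x. t \<in> {0..1} \<Longrightarrow> x \<in> disc \<Longrightarrow> \<mu> t x \<in> disc" for \<mu>
  proof -
    let ?F = "\<lambda>(\<epsilon>, s, t, x). scale_of \<epsilon> s *\<^sub>R (\<lambda>(t, y). disp (\<mu> t) y) (speed_of \<epsilon> s * t, x /\<^sub>R scale_of \<epsilon> s)"
    have "continuous_on ({0..1} \<times> {0..1} \<times> {0..1} \<times> UNIV) ?F"
      by (rule continuous_on_rescaled[OF that(1), of 2]) (auto intro!: norm_disp_le that(2))
    then have "continuous_on ({0..1} \<times> {0..1} \<times> {0..1} \<times> disc) ?F"
      by (rule continuous_on_subset) auto
    moreover have "compact ({0..1::real} \<times> {0..1::real} \<times> disc)"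
      by (intro compact_Times) (auto simp: disc_def)
    ultimately obtain d where d: "0 < d" "\<And>\<epsilon> q. \<epsilon> \<in> {0..1} \<Longrightarrow> \<epsilon> < d \<Longrightarrow> q \<in> {0..1} \<times> {0..1} \<times> disc
        \<Longrightarrow> dist (?F (\<epsilon>, q)) (?F (0, q)) < e"
      using e by (rule uniform_at_zero) blast
    show ?thesis
    proof (intro exI[of _ d] conjI d(1) ballI impI)
      fix \<epsilon> s t :: real and x assume A: "\<epsilon> \<in> {0..1}" "\<epsilon> < d" "s \<in> {0..1}" "t \<in> {0..1}" "x \<in> disc"
      \<comment> \<open>At \<epsilon> = 0 the speed is 1 for s > 0. For s = 0 it is 0 / 0 = 0, but
        there the scale 0 removes the term.\<close>
      have "resc s (\<mu> t) x = x + ?F (0, s, t, x)"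
        by (cases "s = 0") (auto simp: resc_def speed_of_def)
      moreover have "resc (scale_of \<epsilon> s) (\<mu> (speed_of \<epsilon> s * t)) x = x + ?F (\<epsilon>, s, t, x)"
        by (simp add: resc_def)
      ultimately show "dist (resc (scale_of \<epsilon> s) (\<mu> (speed_of \<epsilon> s * t)) x) (resc s (\<mu> t) x) < e"
        using d(2)[OF A(1,2), of "(s, t, x)"] A(3-5) by (simp only: dist_add_cancel) simp
    qed
  qed
  have lim: "((\<lambda>u. d_bar (\<gamma> u) (\<gamma> t)) \<longlongrightarrow> 0) (at t within {0..1})" if "t \<in> {0..1}" for t
    using \<gamma>(1) that by (simp add: Homeo_path_def)
  have c1: "continuous_on ({0..1} \<times> UNIV) (\<lambda>(t, y). disp (\<gamma> t) y)"
    by (rule continuous_on_disp_family[OF Homeo_continuous(1)[OF H] \<gamma>(2) lim])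
       (use dist_le_d_bar(1) b in auto)
  have c2: "continuous_on ({0..1} \<times> UNIV) (\<lambda>(t, y). disp (dinv (\<gamma> t)) y)"
    by (rule continuous_on_disp_family[OF Homeo_continuous(2)[OF H] dinv_boundary[OF b \<gamma>(2)] lim])
       (use dist_le_d_bar(2) b in auto)
  obtain d1 where d1: "0 < d1" "\<And>\<epsilon> s t x. \<lbrakk>\<epsilon> \<in> {0..1}; \<epsilon> < d1; s \<in> {0..1}; t \<in> {0..1}; x \<in> disc\<rbrakk> \<Longrightarrow>
      dist (resc (scale_of \<epsilon> s) (\<gamma> (speed_of \<epsilon> s * t)) x) (resc s (\<gamma> t) x) < e"
    using conv[OF c1 dinv_props(4)[OF b]] by blast
  obtain d2 where d2: "0 < d2" "\<And>\<epsilon> s t x. \<lbrakk>\<epsilon> \<in> {0..1}; \<epsilon> < d2; s \<in> {0..1}; t \<in> {0..1}; x \<in> disc\<rbrakk> \<Longrightarrow>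
      dist (resc (scale_of \<epsilon> s) (dinv (\<gamma> (speed_of \<epsilon> s * t))) x) (resc s (dinv (\<gamma> t)) x) < e"
    using conv[OF c2 dinv_props(3)[OF b]] by blast
  show ?thesis
  proof (rule that[of "min d1 d2"])
    fix \<epsilon> s t :: real assume A: "\<epsilon> \<in> {0..1}" "\<epsilon> < min d1 d2" "s \<in> {0..1}" "t \<in> {0..1}"
    show "d_bar (resc (scale_of \<epsilon> s) (\<gamma> (speed_of \<epsilon> s * t))) (resc s (\<gamma> t)) \<le> e"
    proof (rule d_bar_le)
      fix x assume x: "x \<in> disc"
      show "dist (resc (scale_of \<epsilon> s) (\<gamma> (speed_of \<epsilon> s * t)) x) (resc s (\<gamma> t) x) \<le> e"
        using d1(2)[OF A(1) _ A(3,4) x] A(2) by simp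
      show "dist (dinv (resc (scale_of \<epsilon> s) (\<gamma> (speed_of \<epsilon> s * t))) x) (dinv (resc s (\<gamma> t)) x) \<le> e"
        using d2(2)[OF A(1) _ A(3,4) x] A(2)
        by (simp add: dinv_resc[OF b[OF speed_of_mult_in[OF A(1,3,4)]] scale_of_in[OF A(1,3)] x]
            dinv_resc[OF b[OF A(4)] A(3) x])
    qed
  qed (use d1 d2 in simp)
qed

section \<open>Oscillation and the norm of Hamiltonians\<close>

lemma compact_disc: "compact disc"
  by (simp add: disc_def)

lemma osc_le:
  assumes "\<And>x y. x \<in> disc \<Longrightarrow> y \<in> disc \<Longrightarrow> h x - h y \<le> e"
  shows "osc h \<le> e"
proof -
  have ne: "disc \<noteq> {}" using zero_in_disc by blast
  have "(SUP x\<in>disc. h x) \<le> (INF y\<in>disc. h y) + e"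
  proof (rule cSUP_least[OF ne])
    fix x assume x: "x \<in> disc"
    have "h x - e \<le> (INF y\<in>disc. h y)"
      using assms[OF x] by (intro cINF_greatest[OF ne]) (simp add: algebra_simps)
    then show "h x \<le> (INF y\<in>disc. h y) + e" by simp
  qed
  then show ?thesis by (simp add: osc_def)
qed

lemma le_osc:
  assumes "continuous_on disc h" "x \<in> disc" "y \<in> disc"
  shows "h x - h y \<le> osc h"
proof -
  have bounded: "bounded (h ` disc)"
    by (rule compact_imp_bounded[OF compact_continuous_image[OF assms(1) compact_disc]])
  note b = bounded_imp_bdd_above[OF bounded] bounded_imp_bdd_below[OF bounded]
  show ?thesis
    using cSUP_upper[OF assms(2) b(1)] cINF_lower[OF b(2) assms(3)] by (simp add: osc_def)
qed

lemma osc_cong: "(\<And>x. x \<in> disc \<Longrightarrow> f x = g x) \<Longrightarrow> osc f = osc g"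
  unfolding osc_def by simp

text \<open>Provides the integrability behind every estimate of \<open>L1inf\<close>. By uniform
  continuity nearby times change each value by less than e / 3, hence the oscillation by at most 2 *
  (e / 3).\<close>

lemma continuous_on_osc:
  fixes G :: hamiltonian
  assumes G: "continuous_on ({0..1} \<times> disc) (\<lambda>(t, x). G t x)"
  shows "continuous_on {0..1} (\<lambda>t. osc (G t))"
proof -
  have slice: "continuous_on disc (G t)" if "t \<in> {0..1}" for t
  proof -
    have "continuous_on disc (\<lambda>x. (\<lambda>(t, x). G t x) (t, x))"
      by (rule continuous_on_compose2[OF G]) (use that in \<open>auto intro!: continuous_intros\<close>)
    then show ?thesis by simp
  qed
  have uc: "uniformly_continuous_on ({0..1} \<times> disc) (\<lambda>(t, x). G t x)"
    by (intro compact_uniformly_continuous G compact_Times compact_disc) simp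
  show ?thesis
    unfolding continuous_on_iff
  proof (intro ballI allI impI)
    fix t e :: real assume t: "t \<in> {0..1}" and e: "0 < e"
    from uc e obtain d where d: "0 < d" "\<forall>z\<in>{0..1}\<times>disc. \<forall>w\<in>{0..1}\<times>disc. dist w z < d \<longrightarrow>
        dist ((\<lambda>(t, x). G t x) w) ((\<lambda>(t, x). G t x) z) < e / 3"
      unfolding uniformly_continuous_on_def by (metis zero_less_divide_iff zero_less_numeral)
    have near: "\<bar>G u x - G v x\<bar> < e / 3" if "u \<in> {0..1}" "v \<in> {0..1}" "dist u v < d" "x \<in> disc" for u v x
      using d(2)[rule_format, of "(v, x)" "(u, x)"] that by (simp add: dist_Pair_Pair dist_real_def)
    have le: "osc (G u) \<le> osc (G v) + 2 * (e / 3)" if "u \<in> {0..1}" "v \<in> {0..1}" "dist u v < d" for u v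
    proof (rule osc_le)
      fix x y assume xy: "x \<in> disc" "y \<in> disc"
      show "G u x - G u y \<le> osc (G v) + 2 * (e / 3)"
        using near[OF that xy(1)] near[OF that xy(2)] le_osc[OF slice[OF that(2)] xy] by linarith
    qed
    show "\<exists>d>0. \<forall>u\<in>{0..1}. dist u t < d \<longrightarrow> dist (osc (G u)) (osc (G t)) < e"
    proof (intro exI[of _ d] conjI d(1) ballI impI)
      fix u :: real assume u: "u \<in> {0..1}" "dist u t < d"
      then show "dist (osc (G u)) (osc (G t)) < e"
        using le[OF u(1) t] le[OF t u(1)] e by (simp add: dist_commute dist_real_def)
    qed
  qed
qed

lemma osc_nonneg: "continuous_on disc h \<Longrightarrow> 0 \<le> osc h"
  using le_osc[OF _ zero_in_disc zero_in_disc] by fastforce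

text \<open>Substitution u = b t: running at speed b meets only the times up to b. The primitive of
  f avoids dividing by b, so b = 0 is included.\<close>

lemma integral_speed_le:
  fixes f :: "real \<Rightarrow> real"
  assumes f: "continuous_on {0..1} f" "\<And>t. t \<in> {0..1} \<Longrightarrow> 0 \<le> f t" and b: "b \<in> {0..1}"
  shows "continuous_on {0..1} (\<lambda>t. b * f (b * t))" "integral {0..1} (\<lambda>t. b * f (b * t)) \<le> integral {0..1} f"
proof -
  have bt: "b * t \<in> {0..1}" if "t \<in> {0..1}" for t using b that by (auto intro: mult_le_one)
  show "continuous_on {0..1} (\<lambda>t. b * f (b * t))"
    by (intro continuous_intros continuous_on_compose2[OF f(1)]) (use bt in auto)
  let ?I = "\<lambda>t. integral {0..t} f"
  have "((\<lambda>t. b * f (b * t)) has_integral (?I (b * 1) - ?I (b * 0))) {0..1}"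
  proof (rule fundamental_theorem_of_calculus)
    fix t :: real assume t: "t \<in> {0..1}"
    have "(?I has_vector_derivative f (b * t)) (at (b * t) within {0..1})"
      by (rule integral_has_vector_derivative[OF f(1) bt[OF t]])
    then have "(?I has_vector_derivative f (b * t)) (at (b * t) within (*) b ` {0..1})"
      by (rule has_vector_derivative_within_subset) (use bt in auto)
    moreover have "((*) b has_vector_derivative b) (at t within {0..1})"
      by (auto intro!: derivative_eq_intros)
    ultimately have "(?I \<circ> (*) b has_vector_derivative b *\<^sub>R f (b * t)) (at t within {0..1})"
      by (rule vector_diff_chain_within[rotated])
    then show "((\<lambda>t. ?I (b * t)) has_vector_derivative b * f (b * t)) (at t within {0..1})"
      by (simp add: o_def)
  qed simp
  then have "((\<lambda>t. b * f (b * t)) has_integral integral {0..b} f) {0..1}" by simp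
  then have "integral {0..1} (\<lambda>t. b * f (b * t)) = integral {0..b} f" by (rule integral_unique)
  also have "\<dots> \<le> integral {0..1} f"
    using b f by (intro integral_subset_le integrable_continuous_real)
      (auto intro: continuous_on_subset)
  finally show "integral {0..1} (\<lambda>t. b * f (b * t)) \<le> integral {0..1} f" .
qed

section \<open>Uniqueness of the generating Hamiltonian\<close>

lemma generatesE:
  assumes "generates H \<mu>"
  obtains K where "ham_flow K H \<mu>"
  using assms unfolding generates_def ham_flow_def by blast

text \<open>At every time the flow maps onto the disc, so its velocities determine the field
  everywhere on the disc, and the Hamiltonian up to a constant. The constant is 0 because both
  Hamiltonians vanish at the boundary point (1, 0).\<close>

lemma generates_unique:
  assumes "generates H1 \<mu>" "generates H2 \<mu>" and t: "t \<in> {0..1}"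
  shows "H1 t x = H2 t x"
proof -
  obtain K1 K2 where "ham_flow K1 H1 \<mu>" "ham_flow K2 H2 \<mu>"
    using assms generatesE by metis
  then interpret A: ham_flow K1 H1 \<mu> + B: ham_flow K2 H2 \<mu> .
  let ?D1 = "\<lambda>y. frechet_derivative (H1 t) (at y)" and ?D2 = "\<lambda>y. frechet_derivative (H2 t) (at y)"
  have D1: "(H1 t has_derivative ?D1 y) (at y)" for y by (rule smooth_on_partial(1)[OF A.smooth_H t])
  have D2: "(H2 t has_derivative ?D2 y) (at y)" for y by (rule smooth_on_partial(1)[OF B.smooth_H t])
  have field: "ham_field H1 t y = ham_field H2 t y" if "y \<in> disc" for y
  proof -
    have "y \<in> \<mu> t ` disc" using A.bij_betw_flow[OF t] that by (simp add: bij_betw_def)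
    then obtain z where z: "y = \<mu> t z" "z \<in> disc" by (rule imageE)
    show ?thesis unfolding z(1)
      by (rule vector_derivative_unique_within[OF _ A.flow_deriv[OF z(2) t] B.flow_deriv[OF z(2) t]])
         (use t in \<open>simp add: trivial_limit_within\<close>)
  qed
  have D: "?D1 y w = ?D2 y w" if "y \<in> disc" for y w
  proof -
    interpret l1: linear "?D1 y" using D1 by (rule has_derivative_linear)
    interpret l2: linear "?D2 y" using D2 by (rule has_derivative_linear)
    have "?D1 y (0, 1) = ?D2 y (0, 1)" "?D1 y (1, 0) = ?D2 y (1, 0)"
      using field[OF that] A.ham_field[OF t] B.ham_field[OF t] by auto
    then have "?D1 y (fst w *\<^sub>R (1, 0) + snd w *\<^sub>R (0, 1)) = ?D2 y (fst w *\<^sub>R (1, 0) + snd w *\<^sub>R (0, 1))"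
      unfolding l1.add l1.scaleR l2.add l2.scaleR by simp
    then show ?thesis by simp
  qed
  have out: "H1 t y = H2 t y" if "y \<notin> interior disc" for y
  proof -
    have "y \<notin> K1" "y \<notin> K2" using A.K(2) B.K(2) that by auto
    then show ?thesis using A.H_eq_0[OF t] B.H_eq_0[OF t] by simp
  qed
  show ?thesis
  proof (cases "x \<in> disc")
    case True
    have "\<exists>c. \<forall>y\<in>disc. H1 t y - H2 t y = c"
    proof (rule has_derivative_zero_constant)
      show "convex disc" by (simp add: disc_def)
      fix y assume "y \<in> disc"
      then have "((\<lambda>y. H1 t y - H2 t y) has_derivative (\<lambda>_. 0)) (at y)"
        using has_derivative_diff[OF D1 D2, of y] D by simp
      then show "((\<lambda>y. H1 t y - H2 t y) has_derivative (\<lambda>_. 0)) (at y within disc)"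
        by (rule has_derivative_at_withinI)
    qed
    then obtain c where c: "\<And>y. y \<in> disc \<Longrightarrow> H1 t y - H2 t y = c" by blast
    have "(1, 0) \<in> disc" "(1, 0) \<notin> interior disc" by (auto simp: disc_def)
    then have "c = 0" using c[of "(1, 0)"] out[of "(1, 0)"] by simp
    then show ?thesis using c[OF True] by simp
  next
    case False
    then show ?thesis using out interior_subset by blast
  qed
qed

lemma Dev_eq:
  assumes "generates H \<mu>" "t \<in> {0..1}"
  shows "Dev \<mu> t x = H t x"
  unfolding Dev_def using assms someI[of "\<lambda>H. generates H \<mu>"] by (intro generates_unique[of _ \<mu>]) auto

lemma is_flow_cong:
  assumes "is_flow H \<phi>" "\<And>t x. t \<in> {0..1} \<Longrightarrow> x \<in> disc \<Longrightarrow> \<psi> t x = \<phi> t x"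
  shows "is_flow H \<psi>"
proof -
  have "smooth_on ({0..1} \<times> disc) (\<lambda>(t, x). \<psi> t x)"
    by (rule smooth_on_cong[of _ "\<lambda>(t, x). \<phi> t x"]) (use assms in \<open>auto simp: is_flow_def\<close>)
  moreover have "((\<lambda>u. \<psi> u x) has_vector_derivative ham_field H t (\<psi> t x)) (at t within {0..1})"
    if "x \<in> disc" "t \<in> {0..1}" for x t
  proof -
    have "((\<lambda>u. \<phi> u x) has_vector_derivative ham_field H t (\<phi> t x)) (at t within {0..1})"
      using assms(1) that by (simp add: is_flow_def)
    then have "((\<lambda>u. \<psi> u x) has_vector_derivative ham_field H t (\<phi> t x)) (at t within {0..1})"
      by (rule has_vector_derivative_transform[OF that(2), rotated]) (simp add: assms(2) that)
    then show ?thesis using assms(2) that by simp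
  qed
  ultimately show ?thesis using assms by (auto simp: is_flow_def)
qed

section \<open>Rescaled flows\<close>

text \<open>Conjugation by the dilation of factor \<open>c\<close> scales \<open>\<Omega>\<close>, hence the Hamiltonian, by \<open>c\<^sup>2\<close>; running time
  at speed \<open>b\<close> contributes the factor \<open>b\<close>.\<close>

definition ham_resc :: "real \<Rightarrow> real \<Rightarrow> hamiltonian \<Rightarrow> hamiltonian" where
  "ham_resc c b H t x = c\<^sup>2 * b * H (b * t) (x /\<^sub>R c)"

context ham_flow
begin

lemma boundary_fixed: "t \<in> {0..1} \<Longrightarrow> norm x = 1 \<Longrightarrow> \<phi> t x = x"
  using K(2) by (intro flow_outside) (auto simp: disc_def)

lemma resc_flow_eq:
  assumes "0 < c"
  shows "resc c (\<phi> u) x = c *\<^sub>R flow u (x /\<^sub>R c)"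
  using assms by (simp add: resc_def flow_def scaleR_add_right)

text \<open>Differentiating \<open>ham_resc c b H\<close> costs one factor c, which leaves at c y
  the field c b X_H(b t, y): exactly the velocity of c \<phi>(b t, x / c). Since c \<le> 1, the ball
  of radius r still contains the support.\<close>

lemma ham_flow_resc:
  assumes c: "0 < c" "c \<le> 1" and b: "b \<in> {0..1}" and r: "r < 1" "K \<subseteq> cball 0 r"
  shows "ham_flow (cball 0 r) (ham_resc c b H) (\<lambda>t. resc c (\<phi> (b * t)))"
proof
  show "compact (cball 0 r :: plane set)" "cball 0 r \<subseteq> interior disc" using r by (auto simp: disc_def)
  have bt: "b * t \<in> {0..1}" if "t \<in> {0..1}" for t using b that by (auto intro: mult_le_one)
  have sm: "smooth_on ({0..1} \<times> UNIV) (\<lambda>z::real \<times> plane. (b * fst z, snd z /\<^sub>R c))"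
    by (intro smooth_on_Pair smooth_on_bounded_linear bounded_linear_const_mult bounded_linear_fst
        bounded_linear_scaleR_right bounded_linear_compose[OF bounded_linear_scaleR_right bounded_linear_snd])
  have maps: "(b * fst z, snd z /\<^sub>R c) \<in> {0..1} \<times> UNIV" if "z \<in> {0..1} \<times> UNIV" for z :: "real \<times> plane"
    using bt[of "fst z"] that by (simp only: mem_Times_iff fst_conv UNIV_I)
  show "smooth_hamiltonian (cball 0 r) (ham_resc c b H)"
    unfolding smooth_hamiltonian_def
  proof (intro conjI ballI allI impI)
    have "smooth_on ({0..1} \<times> UNIV) (\<lambda>z::real \<times> plane. (\<lambda>(t, x). H t x) (b * fst z, snd z /\<^sub>R c))"
      by (rule smooth_on_compose[OF smooth_H sm maps])
    from smooth_on_mult[OF smooth_on_const[of _ "c\<^sup>2 * b"] this]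
    have "smooth_on ({0..1} \<times> UNIV) (\<lambda>(t, x). ham_resc c b H t x)"
      by (rule smooth_on_cong) (auto simp: ham_resc_def)
    then show "smooth_on ({0..1} \<times> disc) (\<lambda>(t, x). ham_resc c b H t x)"
      by (rule smooth_on_subset) auto
    fix t :: real and x :: plane assume t: "t \<in> {0..1}" and x: "x \<notin> cball 0 r"
    have "norm x * 1 \<le> norm x * inverse c" using c by (intro mult_left_mono) (auto simp: one_le_inverse)
    then have "norm x \<le> norm (x /\<^sub>R c)" using c by (simp add: mult.commute)
    then have "x /\<^sub>R c \<notin> cball 0 r" using x by simp
    then have "x /\<^sub>R c \<notin> K" using r(2) by blast
    then show "ham_resc c b H t x = 0" using H_eq_0[OF bt[OF t]] by (simp add: ham_resc_def)
  qed
  have field: "ham_field (ham_resc c b H) t (c *\<^sub>R y) = (c * b) *\<^sub>R ham_field H (b * t) y" if t: "t \<in> {0..1}" for t y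
  proof -
    have "((\<lambda>x. H (b * t) (x /\<^sub>R c)) has_derivative (\<lambda>w. frechet_derivative (H (b * t)) (at y) (w /\<^sub>R c))) (at (c *\<^sub>R y))"
    proof (rule has_derivative_compose[where f="\<lambda>x. x /\<^sub>R c"])
      show "(H (b * t) has_derivative frechet_derivative (H (b * t)) (at y)) (at (c *\<^sub>R y /\<^sub>R c))"
        using c smooth_on_partial(1)[OF smooth_H bt[OF t], of y] by simp
    qed (auto intro!: derivative_eq_intros)
    then have "(ham_resc c b H t has_derivative (\<lambda>w. c\<^sup>2 * b * frechet_derivative (H (b * t)) (at y) (w /\<^sub>R c))) (at (c *\<^sub>R y))"
      unfolding ham_resc_def by (rule has_derivative_mult_right)
    moreover have "c\<^sup>2 * b * frechet_derivative (H (b * t)) (at y) (w /\<^sub>R c) = (c * b) * frechet_derivative (H (b * t)) (at y) w" for w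
      using c linear_scale[OF has_derivative_linear[OF smooth_on_partial(1)[OF smooth_H bt[OF t], of y]], of "inverse c" w]
      by (simp add: power2_eq_square)
    ultimately have "(ham_resc c b H t has_derivative (\<lambda>w. (c * b) * frechet_derivative (H (b * t)) (at y) w)) (at (c *\<^sub>R y))"
      by simp
    from ham_field_eq[of "ham_resc c b H", OF this] show ?thesis
      by (simp add: ham_field[OF bt[OF t]])
  qed
  show "is_flow (ham_resc c b H) (\<lambda>t. resc c (\<phi> (b * t)))"
    unfolding is_flow_def
  proof (intro conjI ballI)
    have "smooth_on ({0..1} \<times> UNIV) (\<lambda>z::real \<times> plane. (\<lambda>(t, x). flow t x) (b * fst z, snd z /\<^sub>R c))"
      by (rule smooth_on_compose[OF smooth_flow sm maps])
    from smooth_on_scaleR[OF smooth_on_const[of _ c] this]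
    have "smooth_on ({0..1} \<times> UNIV) (\<lambda>(t, x). resc c (\<phi> (b * t)) x)"
      by (rule smooth_on_cong) (auto simp: resc_flow_eq[OF c(1)])
    then show "smooth_on ({0..1} \<times> disc) (\<lambda>(t, x). resc c (\<phi> (b * t)) x)"
      by (rule smooth_on_subset) auto
    fix x assume x: "x \<in> disc"
    show "resc c (\<phi> (b * 0)) x = x" using c by (simp add: resc_flow_eq flow_zero)
    fix t :: real assume t: "t \<in> {0..1}"
    show "resc c (\<phi> (b * t)) x \<in> disc"
      using c x bt[OF t] flow_in_disc by (intro resc_in_disc) auto
    have "((\<lambda>u. flow u (x /\<^sub>R c)) has_vector_derivative ham_field H (b * t) (flow (b * t) (x /\<^sub>R c))) (at (b * t) within (*) b ` {0..1})"
      by (rule has_vector_derivative_within_subset[OF flow_vector_derivative[OF bt[OF t]]]) (use bt in auto)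
    moreover have "((*) b has_vector_derivative b) (at t within {0..1})"
      by (auto intro!: derivative_eq_intros)
    ultimately have "((\<lambda>u. flow u (x /\<^sub>R c)) \<circ> (*) b has_vector_derivative b *\<^sub>R ham_field H (b * t) (flow (b * t) (x /\<^sub>R c))) (at t within {0..1})"
      by (rule vector_diff_chain_within[rotated])
    then have "((\<lambda>u. c *\<^sub>R flow (b * u) (x /\<^sub>R c)) has_vector_derivative c *\<^sub>R b *\<^sub>R ham_field H (b * t) (flow (b * t) (x /\<^sub>R c))) (at t within {0..1})"
      unfolding o_def by (rule bounded_linear.has_vector_derivative[OF bounded_linear_scaleR_right])
    then show "((\<lambda>u. resc c (\<phi> (b * u)) x) has_vector_derivative
        ham_field (ham_resc c b H) t (resc c (\<phi> (b * t)) x)) (at t within {0..1})"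
      by (simp add: resc_flow_eq[OF c(1)] field[OF t])
  qed
qed

text \<open>For \<epsilon> > 0 both the scale and the denominator s + \<epsilon> stay positive on
  the closed parameter square, so all divisions are smooth; the radius r does not depend on the
  parameters.\<close>

lemma smooth_into_Ham_resc:
  assumes \<epsilon>: "0 < \<epsilon>" "\<epsilon> \<le> 1"
  shows "smooth_into_Ham ({0..1} \<times> {0..1}) (\<lambda>(s, t). resc (scale_of \<epsilon> s) (\<phi> (speed_of \<epsilon> s * t)))"
proof -
  obtain r where r: "0 \<le> r" "r < 1" "K \<subseteq> cball 0 r" using compact_subset_interior_disc[OF K] .
  have \<epsilon>': "\<epsilon> \<in> {0..1}" using \<epsilon> by simp
  have flows: "ham_flow (cball 0 r) (ham_resc (scale_of \<epsilon> s) (speed_of \<epsilon> s) H)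
      (\<lambda>t. resc (scale_of \<epsilon> s) (\<phi> (speed_of \<epsilon> s * t)))" if "s \<in> {0..1}" for s
    by (intro ham_flow_resc r) (use \<epsilon> that scale_of_in[OF \<epsilon>' that] speed_of_in[OF \<epsilon>' that] scale_of_pos in auto)
  let ?P = "({0..1} \<times> {0..1}) \<times> disc :: ((real \<times> real) \<times> plane) set"
  let ?s = "\<lambda>z :: (real \<times> real) \<times> plane. fst (fst z)"
  have s: "smooth_on ?P ?s"
    by (intro smooth_on_bounded_linear bounded_linear_compose[OF bounded_linear_fst bounded_linear_fst])
  have t: "smooth_on ?P (\<lambda>z. snd (fst z))"
    by (intro smooth_on_bounded_linear bounded_linear_compose[OF bounded_linear_snd bounded_linear_fst])
  have sc: "smooth_on ?P (\<lambda>z. scale_of \<epsilon> (?s z))"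
    unfolding scale_of_def divide_inverse
    by (intro smooth_on_mult smooth_on_add smooth_on_const s)
  have sp: "smooth_on ?P (\<lambda>z. speed_of \<epsilon> (?s z))"
    unfolding speed_of_def divide_inverse
    by (intro smooth_on_mult smooth_on_inverse smooth_on_add smooth_on_const s) (use \<epsilon> in auto)
  have "smooth_on ?P (\<lambda>z. scale_of \<epsilon> (?s z) *\<^sub>R (\<lambda>(t, x). flow t x)
      (speed_of \<epsilon> (?s z) * snd (fst z), inverse (scale_of \<epsilon> (?s z)) *\<^sub>R snd z))"
  proof (intro smooth_on_scaleR smooth_on_compose[OF smooth_flow] smooth_on_Pair smooth_on_mult smooth_on_inverse
      sc sp t smooth_on_bounded_linear bounded_linear_snd)
    show "scale_of \<epsilon> (?s z) \<noteq> 0" if "z \<in> ?P" for z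
      using scale_of_pos[OF \<epsilon>(1), of "?s z"] that by auto
    show "(speed_of \<epsilon> (?s z) * snd (fst z), inverse (scale_of \<epsilon> (?s z)) *\<^sub>R snd z) \<in> {0..1} \<times> UNIV"
      if "z \<in> ?P" for z
      using speed_of_mult_in[OF \<epsilon>', of "?s z" "snd (fst z)"] that by (cases z) auto
  qed
  then have "smooth_on ?P (\<lambda>(a, x). (\<lambda>(s, t). resc (scale_of \<epsilon> s) (\<phi> (speed_of \<epsilon> s * t))) a x)"
    by (rule smooth_on_cong) (use scale_of_pos[OF \<epsilon>(1)] in \<open>auto simp: resc_flow_eq\<close>)
  moreover have "(\<lambda>(s, t). resc (scale_of \<epsilon> s) (\<phi> (speed_of \<epsilon> s * t))) a \<in> Symp
      \<and> supported_in (cball 0 r) ((\<lambda>(s, t). resc (scale_of \<epsilon> s) (\<phi> (speed_of \<epsilon> s * t))) a)"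
    if A: "a \<in> {0..1} \<times> {0..1}" for a
  proof -
    obtain s t where a: "a = (s, t)" "s \<in> {0..1}" "t \<in> {0..1}" using A by auto
    interpret R: ham_flow "cball 0 r" "ham_resc (scale_of \<epsilon> s) (speed_of \<epsilon> s) H"
      "\<lambda>t. resc (scale_of \<epsilon> s) (\<phi> (speed_of \<epsilon> s * t))" by (rule flows[OF a(2)])
    show ?thesis using R.flow_Symp[OF a(3)] R.flow_outside[OF _ _ a(3)] by (simp add: a(1) supported_in_def)
  qed
  moreover have "compact (cball 0 r :: plane set)" "cball 0 r \<subseteq> interior disc" using r by (auto simp: disc_def)
  ultimately show ?thesis unfolding smooth_into_Ham_def by blast
qed

end

section \<open>Contracting topological Hamiltonian loops\<close>

text \<open>\<open>osc\<close> sees only the disc, but rescaled arguments leave it. The value 0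
  taken off the disc is also attained at the boundary point (1, 0).\<close>

lemma diff_le_osc:
  assumes "continuous_on disc h" "K \<subseteq> interior disc" "\<And>x. x \<notin> K \<Longrightarrow> h x = 0"
  shows "h x - h y \<le> osc h"
proof -
  have "(1, 0) \<in> disc" "(1, 0) \<notin> K" using assms(2) by (auto simp: disc_def)
  then have "\<exists>z'\<in>disc. h z = h z'" for z
    using assms interior_subset[of disc] by (cases "z \<in> disc") (metis subsetD)+
  then obtain x' y' where "x' \<in> disc" "h x = h x'" "y' \<in> disc" "h y = h y'" by metis
  then show ?thesis using le_osc[OF assms(1), of x' y'] by simp
qed

context ham_flow
begin

lemma continuous_H: "continuous_on ({0..1} \<times> disc) (\<lambda>(t, x). H t x)"
  by (rule continuous_on_subset[OF smooth_on_imp_continuous_on[OF smooth_H]]) auto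

text \<open>Both parameters are compared with the continuous limit at \<epsilon> = 0. The resulting
  d depends on this particular H through its continuity.\<close>

lemma ham_resc_continuous_family:
  assumes e: "0 < e"
  obtains d where "0 < d"
    "\<And>\<epsilon> \<epsilon>' s t x. \<epsilon> \<in> {0<..1} \<Longrightarrow> \<epsilon>' \<in> {0<..1} \<Longrightarrow> \<epsilon> < d \<Longrightarrow> \<epsilon>' < d \<Longrightarrow> s \<in> {0..1} \<Longrightarrow> t \<in> {0..1} \<Longrightarrow> x \<in> disc \<Longrightarrow>
      \<bar>ham_resc (scale_of \<epsilon> s) (speed_of \<epsilon> s) H t x - ham_resc (scale_of \<epsilon>' s) (speed_of \<epsilon>' s) H t x\<bar> < e"
proof -
  have "bounded ((\<lambda>(t, x). H t x) ` ({0..1} \<times> disc))"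
    by (intro compact_imp_bounded compact_continuous_image continuous_H compact_Times compact_disc) simp
  then obtain M where M: "0 < M" "\<forall>y\<in>(\<lambda>(t, x). H t x) ` ({0..1} \<times> disc). norm y \<le> M"
    unfolding bounded_pos by blast
  have bound: "norm ((\<lambda>(t, x). H t x) z) \<le> M" if "z \<in> {0..1} \<times> UNIV" for z
  proof (cases "snd z \<in> disc")
    case True
    then show ?thesis using M(2) that by (intro bspec[OF M(2)] imageI) (auto simp: mem_Times_iff)
  next
    case False
    then have "snd z \<notin> K" using K_subset_disc by blast
    then show ?thesis using M(1) H_eq_0[of "fst z" "snd z"] that
      by (simp add: case_prod_unfold mem_Times_iff)
  qed
  let ?F = "\<lambda>(\<epsilon>, s, t, x). scale_of \<epsilon> s *\<^sub>R (\<lambda>(t, x). H t x) (speed_of \<epsilon> s * t, x /\<^sub>R scale_of \<epsilon> s)"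
  \<comment> \<open>In c^2 b one factor c combines with b to s / (1 + \<epsilon>), continuous also
    at s = \<epsilon> = 0; the remaining c puts the rest into the form of
    \<open>continuous_on_rescaled\<close>.\<close>
  let ?G = "\<lambda>z. (fst (snd z) / (1 + fst z)) *\<^sub>R ?F z"
  have "continuous_on ({0..1} \<times> {0..1} \<times> {0..1} \<times> UNIV) ?F"
    by (rule continuous_on_rescaled[OF smooth_on_imp_continuous_on[OF smooth_H] bound])
  then have F: "continuous_on ({0..1} \<times> {0..1} \<times> {0..1} \<times> disc) ?F"
    by (rule continuous_on_subset) auto
  have "continuous_on ({0..1} \<times> {0..1} \<times> {0..1} \<times> disc) ?G"
    by (intro continuous_on_scaleR F continuous_intros) auto
  moreover have "compact ({0..1::real} \<times> {0..1::real} \<times> disc)"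
    by (intro compact_Times compact_disc) auto
  ultimately obtain d where d: "0 < d" "\<And>\<epsilon> q. \<epsilon> \<in> {0..1} \<Longrightarrow> \<epsilon> < d \<Longrightarrow> q \<in> {0..1} \<times> {0..1} \<times> disc
      \<Longrightarrow> dist (?G (\<epsilon>, q)) (?G (0, q)) < e / 2"
    using half_gt_zero[OF e] by (rule uniform_at_zero) blast
  have G: "ham_resc (scale_of \<epsilon> s) (speed_of \<epsilon> s) H t x = ?G (\<epsilon>, s, t, x)" if "0 < \<epsilon>" "0 \<le> s" for \<epsilon> s t x
  proof -
    have "scale_of \<epsilon> s * speed_of \<epsilon> s = s / (1 + \<epsilon>)"
      using that by (simp add: scale_of_def speed_of_def)
    then show ?thesis by (simp add: ham_resc_def power2_eq_square mult.assoc mult.left_commute)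
  qed
  show ?thesis
  proof (rule that[OF d(1)])
    fix \<epsilon> \<epsilon>' s t :: real and x :: plane
    assume A: "\<epsilon> \<in> {0<..1}" "\<epsilon>' \<in> {0<..1}" "\<epsilon> < d" "\<epsilon>' < d" "s \<in> {0..1}" "t \<in> {0..1}" "x \<in> disc"
    have "dist (?G (\<epsilon>, s, t, x)) (?G (0, s, t, x)) < e / 2" "dist (?G (\<epsilon>', s, t, x)) (?G (0, s, t, x)) < e / 2"
      by (rule d(2); use A in simp)+
    then have "dist (?G (\<epsilon>, s, t, x)) (?G (\<epsilon>', s, t, x)) < e" by (rule dist_triangle_half_l)
    then show "\<bar>ham_resc (scale_of \<epsilon> s) (speed_of \<epsilon> s) H t x - ham_resc (scale_of \<epsilon>' s) (speed_of \<epsilon>' s) H t x\<bar> < e"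
      using A G[of \<epsilon> s t x] G[of \<epsilon>' s t x] by (simp only: dist_real_def) simp
  qed
qed

end

text \<open>c^2 is bounded by 1, but the factor b is kept: it is the Jacobian that the time
  substitution will consume.\<close>

lemma ham_resc_diff_le:
  assumes D: "continuous_on disc (D (b * t))" "K \<subseteq> interior disc" "\<And>x. x \<notin> K \<Longrightarrow> D (b * t) x = 0"
    and c: "c \<in> {0..1}" and b: "0 \<le> b"
  shows "ham_resc c b D t x - ham_resc c b D t y \<le> b * osc (D (b * t))"
proof -
  have "c\<^sup>2 * b * (D (b * t) (x /\<^sub>R c) - D (b * t) (y /\<^sub>R c)) \<le> c\<^sup>2 * b * osc (D (b * t))"
    using b by (intro mult_left_mono diff_le_osc[OF D]) auto
  also have "\<dots> \<le> 1 * b * osc (D (b * t))"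
    using b c osc_nonneg[OF D(1)] by (intro mult_right_mono) (auto simp: power_le_one)
  finally show ?thesis by (simp add: ham_resc_def right_diff_distrib)
qed

lemma ham_resc_diff: "ham_resc c b (\<lambda>t x. F t x - G t x) t x = ham_resc c b F t x - ham_resc c b G t x"
  by (simp add: ham_resc_def right_diff_distrib)

text \<open>Passes from H i to H n at the parameters of i, changes the parameters with H n fixed,
  and returns to H j. The outer steps use that \<open>ham_resc\<close> is linear in the Hamiltonian
  and does not increase the norm, the middle one continuity of the single H n.\<close>

lemma ham_resc_Cauchy:
  fixes H :: "nat \<Rightarrow> hamiltonian"
  assumes flows: "\<And>i. ham_flow K (H i) (\<Phi> i)"
    and Cauchy: "\<forall>\<epsilon>>0. \<exists>N. \<forall>i\<ge>N. \<forall>j\<ge>N. L1inf (\<lambda>t x. H i t x - H j t x) < \<epsilon>"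
    and eps: "\<And>i. eps i \<in> {0<..1}" "eps \<longlonglongrightarrow> 0" and e: "0 < e"
  shows "\<exists>N. \<forall>i\<ge>N. \<forall>j\<ge>N. \<forall>s\<in>{0..1}.
    L1inf (\<lambda>t x. ham_resc (scale_of (eps i) s) (speed_of (eps i) s) (H i) t x -
      ham_resc (scale_of (eps j) s) (speed_of (eps j) s) (H j) t x) < e"
proof -
  \<comment> \<open>Two outer steps cost e / 4 each; the middle one costs e / 8 at each of two
    points, hence e / 4 in oscillation.\<close>
  have e4: "0 < e / 4" using e by simp
  then obtain n where "\<forall>i\<ge>n. \<forall>j\<ge>n. L1inf (\<lambda>t x. H i t x - H j t x) < e / 4"
    using Cauchy by blast
  then have n: "L1inf (\<lambda>t x. H i t x - H j t x) < e / 4" if "n \<le> i" "n \<le> j" for i j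
    using that by blast
  interpret Hn: ham_flow K "H n" "\<Phi> n" by (rule flows)
  have e8: "0 < e / 8" using e by simp
  obtain d where d: "0 < d"
    "\<And>\<epsilon> \<epsilon>' s t x. \<lbrakk>\<epsilon> \<in> {0<..1}; \<epsilon>' \<in> {0<..1}; \<epsilon> < d; \<epsilon>' < d; s \<in> {0..1}; t \<in> {0..1}; x \<in> disc\<rbrakk> \<Longrightarrow>
      \<bar>ham_resc (scale_of \<epsilon> s) (speed_of \<epsilon> s) (H n) t x - ham_resc (scale_of \<epsilon>' s) (speed_of \<epsilon>' s) (H n) t x\<bar> < e / 8"
    using Hn.ham_resc_continuous_family[OF e8] by blast
  obtain m where m: "\<And>i. m \<le> i \<Longrightarrow> eps i < d"
    using order_tendstoD(2)[OF eps(2) d(1)] by (auto simp: eventually_sequentially)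
  obtain r where r: "0 \<le> r" "r < 1" "K \<subseteq> cball 0 r" using compact_subset_interior_disc[OF Hn.K] .
  let ?A = "\<lambda>i s. ham_resc (scale_of (eps i) s) (speed_of (eps i) s)"
  let ?D = "\<lambda>i t x. H i t x - H n t x"
  have cD: "continuous_on ({0..1} \<times> disc) (\<lambda>(t, x). ?D i t x)" for i
    using continuous_on_diff[OF ham_flow.continuous_H[OF flows] ham_flow.continuous_H[OF flows], of i n]
    by (simp add: case_prod_unfold)
  have slice: "continuous_on disc (?D i t)" if "t \<in> {0..1}" for i t
  proof -
    have "continuous_on disc (\<lambda>x. (\<lambda>(t, x). ?D i t x) (t, x))"
      by (rule continuous_on_compose2[OF cD]) (use that in \<open>auto intro!: continuous_intros\<close>)
    then show ?thesis by simp
  qed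
  have D0: "?D i t x = 0" if "t \<in> {0..1}" "x \<notin> K" for i t x
    using ham_flow.H_eq_0[OF flows that] by simp
  show ?thesis
  proof (intro exI[of _ "max n m"] allI impI ballI)
    fix i j s assume ij: "max n m \<le> i" "max n m \<le> j" and s: "s \<in> {0..1::real}"
    have param: "scale_of (eps k) s \<in> {0..1}" "0 < scale_of (eps k) s" "speed_of (eps k) s \<in> {0..1}"
      "\<And>t. t \<in> {0..1} \<Longrightarrow> speed_of (eps k) s * t \<in> {0..1}" for k
      using eps(1)[of k] s scale_of_in[of "eps k" s] scale_of_pos[of "eps k" s] speed_of_in[of "eps k" s]
        speed_of_mult_in[of "eps k" s] by auto
    have cA: "continuous_on ({0..1} \<times> disc) (\<lambda>(t, x). ?A k s (H k) t x)" for k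
      by (rule ham_flow.continuous_H[OF ham_flow.ham_flow_resc[OF flows _ _ _ r(2,3)]]) (use param[of k] in auto)
    define w where "w k t = speed_of (eps k) s * osc (?D k (speed_of (eps k) s * t))" for k t
    have w: "continuous_on {0..1} (w k)" "integral {0..1} (w k) \<le> L1inf (?D k)" for k
      unfolding w_def L1inf_def
      by (rule integral_speed_le[where f="\<lambda>t. osc (?D k t)"]; use continuous_on_osc[OF cD] osc_nonneg[OF slice] param(3) in blast)+
    have est: "\<bar>(?A k s (H k) t x - ?A k s (H n) t x) - (?A k s (H k) t y - ?A k s (H n) t y)\<bar> \<le> w k t"
      if t: "t \<in> {0..1}" for k t x y
    proof -
      have b: "0 \<le> speed_of (eps k) s" using param(3) by simp
      have "?A k s (?D k) t x - ?A k s (?D k) t y \<le> w k t" for x y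
        unfolding w_def
        by (rule ham_resc_diff_le[where D="?D k", OF slice[OF param(4)[OF t]] Hn.K(2) D0[OF param(4)[OF t]] param(1) b])
      from this[of x y] this[of y x] show ?thesis
        unfolding ham_resc_diff by linarith
    qed
    have osc: "osc (\<lambda>x. ?A i s (H i) t x - ?A j s (H j) t x) \<le> w i t + w j t + e / 4" if t: "t \<in> {0..1}" for t
    proof (rule osc_le)
      fix x y assume xy: "x \<in> disc" "y \<in> disc"
      have "\<bar>?A i s (H n) t x - ?A j s (H n) t x\<bar> < e / 8" "\<bar>?A i s (H n) t y - ?A j s (H n) t y\<bar> < e / 8"
        using d(2)[OF eps(1) eps(1) m m s t] xy ij by auto
      then show "?A i s (H i) t x - ?A j s (H j) t x - (?A i s (H i) t y - ?A j s (H j) t y) \<le> w i t + w j t + e / 4"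
        using est[OF t, of i x y] est[OF t, of j x y] by linarith
    qed
    have "continuous_on ({0..1} \<times> disc) (\<lambda>(t, x). ?A i s (H i) t x - ?A j s (H j) t x)"
      using continuous_on_diff[OF cA cA, of i j] by (simp add: case_prod_unfold)
    then have "L1inf (\<lambda>t x. ?A i s (H i) t x - ?A j s (H j) t x) \<le> integral {0..1} (\<lambda>t. w i t + w j t + e / 4)"
      unfolding L1inf_def
      by (intro integral_le integrable_continuous_real continuous_on_osc continuous_on_add w continuous_on_const osc)
    also have "\<dots> = integral {0..1} (w i) + integral {0..1} (w j) + e / 4"
      by (simp add: integral_add integrable_add integrable_continuous_real w)
    also have "\<dots> < e"
      using w(2)[of i] w(2)[of j] n[of i n] n[of j n] ij e by simp
    finally show "L1inf (\<lambda>t x. ?A i s (H i) t x - ?A j s (H j) t x) < e" .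
  qed
qed

section \<open>Alexander's isotopy as a hameotopy\<close>

lemma resc_identity:
  assumes "\<And>x. x \<in> disc \<Longrightarrow> f x = x"
  shows "resc c f x = x"
  by (simp add: resc_def disp_def assms)

lemma hameotopy_Alexander:
  assumes \<gamma>: "topological_ham_path \<gamma>" and \<gamma>0: "\<forall>x\<in>disc. \<gamma> 0 x = x"
  shows "hameotopy (\<lambda>t x. x) \<gamma> (\<lambda>s t. resc s (\<gamma> t))"
proof -
  have path: "Homeo_path \<gamma>" using \<gamma> by (simp add: topological_ham_path_def)
  obtain K H \<Phi> where K: "compact K" "K \<subseteq> interior disc"
    and fl: "\<forall>i::nat. smooth_hamiltonian K (H i) \<and> is_flow (H i) (\<Phi> i)"
    and conv: "(\<lambda>i. d_bar_path (\<Phi> i) \<gamma>) \<longlonglongrightarrow> 0"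
    and Cauchy: "\<forall>\<epsilon>>0. \<exists>N. \<forall>i\<ge>N. \<forall>j\<ge>N. L1inf (\<lambda>t x. H i t x - H j t x) < \<epsilon>"
    using \<gamma> unfolding topological_ham_path_def by blast
  have flows: "ham_flow K (H i) (\<Phi> i)" for i using K fl by (simp add: ham_flow_def)
  obtain r where r: "0 \<le> r" "r < 1" "K \<subseteq> cball 0 r" using compact_subset_interior_disc[OF K] .
  have Homeo: "\<gamma> t \<in> Homeo" if "t \<in> {0..1}" for t using path that by (simp add: Homeo_path_def)
  have bij: "bij_betw (\<gamma> t) disc disc" if "t \<in> {0..1}" for t using Homeo_bij Homeo that by blast
  have bij\<Phi>: "bij_betw (\<Phi> i t) disc disc" if "t \<in> {0..1}" for i t
    using ham_flow.bij_betw_flow[OF flows that] .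
  \<comment> \<open>The approximating flows fix the unit circle, hence so does their uniform limit;
    this makes the extension of \<gamma> by the identity continuous.\<close>
  have bd: "\<gamma> t x = x" if t: "t \<in> {0..1}" and x: "norm x = 1" for t x
  proof -
    have "dist x (\<gamma> t x) \<le> d_bar_path (\<Phi> i) \<gamma>" for i
    proof -
      have "x \<in> disc" using x by (simp add: disc_def)
      then have "dist (\<Phi> i t x) (\<gamma> t x) \<le> d_bar (\<Phi> i t) (\<gamma> t)"
        by (rule dist_le_d_bar(1)[OF bij\<Phi>[OF t] bij[OF t]])
      also have "\<dots> \<le> d_bar_path (\<Phi> i) \<gamma>" by (rule d_bar_le_path[OF bij\<Phi> bij t])
      finally show ?thesis by (simp add: ham_flow.boundary_fixed[OF flows t x])
    qed
    then have "dist x (\<gamma> t x) \<le> 0" by (intro LIMSEQ_le_const[OF conv]) auto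
    then show ?thesis by simp
  qed
  define eps where "eps j = inverse (real (Suc j))" for j
  have eps: "eps j \<in> {0<..1}" for j by (simp add: eps_def divide_simps)
  have eps': "eps j \<in> {0..1}" "0 < eps j" "eps j \<le> 1" for j using eps[of j] by simp_all
  have eps0: "eps \<longlonglongrightarrow> 0" unfolding eps_def by (rule LIMSEQ_inverse_real_of_nat)
  define \<Lambda>j where "\<Lambda>j j s t = resc (scale_of (eps j) s) (\<Phi> j (speed_of (eps j) s * t))" for j s t
  define Hj where "Hj j s = ham_resc (scale_of (eps j) s) (speed_of (eps j) s) (H j)" for j s
  have flowj: "ham_flow (cball 0 r) (Hj j s) (\<Lambda>j j s)" if "s \<in> {0..1}" for j s
    unfolding \<Lambda>j_def Hj_def using scale_of_in[OF eps'(1) that] speed_of_in[OF eps'(1) that] scale_of_pos[OF eps'(2)] that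
    by (intro ham_flow.ham_flow_resc[OF flows] r) auto
  have bijj: "bij_betw (\<Lambda>j j s t) disc disc" if "s \<in> {0..1}" "t \<in> {0..1}" for j s t
    by (rule ham_flow.bij_betw_flow[OF flowj[OF that(1)] that(2)])
  have bijL: "bij_betw (resc s (\<gamma> t)) disc disc" if "s \<in> {0..1}" "t \<in> {0..1}" for s t
    by (rule resc_bij[OF bij[OF that(2)] that(1)])
  \<comment> \<open>Triangle through \<gamma> at the scale and speed of the j-th approximation:
    replacing \<open>\<Phi> j\<close> by \<gamma> costs at most their distance, since conjugation is
    a contraction, and undoing the change of scale and speed is
    \<open>rescaled_path_converges\<close>.\<close>
  have unif: "\<exists>N. \<forall>j\<ge>N. \<forall>s\<in>{0..1}. \<forall>t\<in>{0..1}. d_bar (\<Lambda>j j s t) (resc s (\<gamma> t)) < e" if e: "0 < e" for e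
  proof -
    obtain d where d: "0 < d" "\<And>\<epsilon> s t. \<lbrakk>\<epsilon> \<in> {0..1}; \<epsilon> < d; s \<in> {0..1}; t \<in> {0..1}\<rbrakk> \<Longrightarrow>
        d_bar (resc (scale_of \<epsilon> s) (\<gamma> (speed_of \<epsilon> s * t))) (resc s (\<gamma> t)) \<le> e / 2"
      using rescaled_path_converges[OF path bd half_gt_zero[OF e]] by blast
    have "\<forall>\<^sub>F j in sequentially. eps j < d \<and> d_bar_path (\<Phi> j) \<gamma> < e / 2"
      using order_tendstoD(2)[OF eps0 d(1)] order_tendstoD(2)[OF conv half_gt_zero[OF e]] by (rule eventually_conj)
    then obtain N where N: "\<And>j. N \<le> j \<Longrightarrow> eps j < d" "\<And>j. N \<le> j \<Longrightarrow> d_bar_path (\<Phi> j) \<gamma> < e / 2"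
      unfolding eventually_sequentially by blast
    show ?thesis
    proof (intro exI[of _ N] allI impI ballI)
      fix j s t assume j: "N \<le> j" and s: "s \<in> {0..1::real}" and t: "t \<in> {0..1::real}"
      let ?c = "scale_of (eps j) s" and ?u = "speed_of (eps j) s * t"
      have c: "?c \<in> {0..1}" by (rule scale_of_in[OF eps'(1) s])
      have u: "?u \<in> {0..1}" by (rule speed_of_mult_in[OF eps'(1) s t])
      have "d_bar (\<Lambda>j j s t) (resc s (\<gamma> t)) \<le> d_bar (\<Lambda>j j s t) (resc ?c (\<gamma> ?u)) + d_bar (resc ?c (\<gamma> ?u)) (resc s (\<gamma> t))"
        by (intro d_bar_triangle bijj bijL s t c u)
      also have "d_bar (\<Lambda>j j s t) (resc ?c (\<gamma> ?u)) \<le> d_bar (\<Phi> j ?u) (\<gamma> ?u)"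
        unfolding \<Lambda>j_def by (rule d_bar_resc_le[OF bij\<Phi>[OF u] bij[OF u] c])
      also have "\<dots> \<le> d_bar_path (\<Phi> j) \<gamma>" by (rule d_bar_le_path[OF bij\<Phi> bij u])
      also have "\<dots> < e / 2" by (rule N(2)[OF j])
      also have "d_bar (resc ?c (\<gamma> ?u)) (resc s (\<gamma> t)) \<le> e / 2" by (rule d(2)[OF eps'(1) N(1)[OF j] s t])
      finally show "d_bar (\<Lambda>j j s t) (resc s (\<gamma> t)) < e" by simp
    qed
  qed
  have zero: "\<Lambda>j j 0 t x = x" for j t x
    unfolding \<Lambda>j_def by (rule resc_identity) (simp add: speed_of_def ham_flow.flow_0[OF flows])
  \<comment> \<open>\<open>\<Lambda>j j 0 t\<close> is the identity because the speed at s = 0 is 0,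
    so composing with its inverse changes nothing on the disc. Off the disc \<open>dinv\<close> is
    arbitrary; hence the passage through \<open>is_flow_cong\<close>.\<close>
  define \<Psi> where "\<Psi> j s t = \<Lambda>j j s t \<circ> dinv (\<Lambda>j j 0 t)" for j s t
  have \<Psi>: "\<Psi> j s t x = \<Lambda>j j s t x" if "x \<in> disc" for j s t x
    using dinv_cong[of "\<Lambda>j j 0 t" "\<lambda>x. x"] dinv_eqI[of "\<lambda>x. x" x x] that
    by (simp add: \<Psi>_def zero bij_betw_def)
  have gen: "generates (Hj j s) (\<Psi> j s)" if s: "s \<in> {0..1}" for j s
  proof -
    interpret R: ham_flow "cball 0 r" "Hj j s" "\<Lambda>j j s" by (rule flowj[OF s])
    show ?thesis unfolding generates_def
      using R.K R.smooth_hamiltonian is_flow_cong[OF R.is_flow \<Psi>] by blast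
  qed
  have pathL: "Homeo_path (\<lambda>t. resc s (\<gamma> t))" if s: "s \<in> {0..1}" for s
    unfolding Homeo_path_def
  proof (intro conjI ballI)
    fix t :: real assume t: "t \<in> {0..1}"
    show "resc s (\<gamma> t) \<in> Homeo" by (rule resc_Homeo[OF Homeo[OF t] bd[OF t] s])
    have lim: "((\<lambda>u. d_bar (\<gamma> u) (\<gamma> t)) \<longlongrightarrow> 0) (at t within {0..1})" using path t by (simp add: Homeo_path_def)
    show "((\<lambda>u. d_bar (resc s (\<gamma> u)) (resc s (\<gamma> t))) \<longlongrightarrow> 0) (at t within {0..1})"
    proof (rule Lim_null_comparison[OF _ lim], unfold eventually_at_filter, intro always_eventually allI impI)
      fix u :: real assume u: "u \<in> {0..1}"
      show "norm (d_bar (resc s (\<gamma> u)) (resc s (\<gamma> t))) \<le> d_bar (\<gamma> u) (\<gamma> t)"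
        using d_bar_bounds(1)[OF bijL[OF s u] bijL[OF s t]] d_bar_resc_le[OF bij[OF u] bij[OF t] s] by simp
    qed
  qed
  have cong: "d_bar_path (\<Psi> j s) \<mu> = d_bar_path (\<Lambda>j j s) \<mu>" for j s \<mu>
    unfolding d_bar_path_def by (intro SUP_cong refl d_bar_cong \<Psi>)
  have conv\<Psi>: "uniform_limit {0..1} (\<lambda>j s. d_bar_path (\<Psi> j s) (\<lambda>t. resc s (\<gamma> t))) (\<lambda>s. 0) sequentially"
    unfolding uniform_limit_sequentially_iff
  proof (intro allI impI)
    fix e :: real assume e: "0 < e"
    obtain N where N: "\<forall>j\<ge>N. \<forall>s\<in>{0..1}. \<forall>t\<in>{0..1}. d_bar (\<Lambda>j j s t) (resc s (\<gamma> t)) < e / 2"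
      using unif[OF half_gt_zero[OF e]] by blast
    show "\<exists>N. \<forall>j\<ge>N. \<forall>s\<in>{0..1}. dist (d_bar_path (\<Psi> j s) (\<lambda>t. resc s (\<gamma> t))) 0 < e"
    proof (intro exI[of _ N] allI impI ballI)
      fix j s assume j: "N \<le> j" and s: "s \<in> {0..1::real}"
      have "d_bar_path (\<Lambda>j j s) (\<lambda>t. resc s (\<gamma> t)) \<le> e / 2"
        using N j s by (intro d_bar_path_le) (auto intro: less_imp_le)
      moreover have "0 \<le> d_bar_path (\<Lambda>j j s) (\<lambda>t. resc s (\<gamma> t))"
        using d_bar_le_path[of "\<Lambda>j j s" "\<lambda>t. resc s (\<gamma> t)" 0, OF bijj[OF s] bijL[OF s]]
          d_bar_bounds(1)[OF bijj[OF s, of 0 j] bijL[OF s, of 0]] by simp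
      ultimately show "dist (d_bar_path (\<Psi> j s) (\<lambda>t. resc s (\<gamma> t))) 0 < e"
        using e by (simp add: cong)
    qed
  qed
  have Cauchy\<Psi>: "\<forall>e>0. \<exists>N. \<forall>i\<ge>N. \<forall>j\<ge>N. \<forall>s\<in>{0..1}. L1inf (\<lambda>t x. Dev (\<Psi> i s) t x - Dev (\<Psi> j s) t x) < e"
  proof (intro allI impI)
    fix e :: real assume e: "0 < e"
    have "L1inf (\<lambda>t x. Dev (\<Psi> i s) t x - Dev (\<Psi> j s) t x) = L1inf (\<lambda>t x. Hj i s t x - Hj j s t x)" if s: "s \<in> {0..1}" for i j s
      unfolding L1inf_def by (intro integral_cong osc_cong) (simp add: Dev_eq[OF gen[OF s]])
    then show "\<exists>N. \<forall>i\<ge>N. \<forall>j\<ge>N. \<forall>s\<in>{0..1}. L1inf (\<lambda>t x. Dev (\<Psi> i s) t x - Dev (\<Psi> j s) t x) < e"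
      using ham_resc_Cauchy[OF flows Cauchy eps eps0 e] by (simp add: Hj_def)
  qed
  show ?thesis
    unfolding hameotopy_def
  proof (intro conjI ballI exI[of _ \<Lambda>j] allI)
    fix s t :: real assume s: "s \<in> {0..1}" and t: "t \<in> {0..1}"
    \<comment> \<open>The smooth approximations of the homotopy themselves witness that its values
      lie in the closure of \<open>Symp\<close>.\<close>
    have "\<exists>\<psi>\<in>Symp. d_C0 \<psi> (resc s (\<gamma> t)) < e" if "0 < e" for e
    proof -
      obtain N where "\<forall>j\<ge>N. \<forall>s\<in>{0..1}. \<forall>t\<in>{0..1}. d_bar (\<Lambda>j j s t) (resc s (\<gamma> t)) < e"
        using unif[OF \<open>0 < e\<close>] by blast
      then have "d_bar (\<Lambda>j N s t) (resc s (\<gamma> t)) < e" using s t by blast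
      then show ?thesis using ham_flow.flow_Symp[OF flowj[OF s] t, of N] by (auto simp: d_bar_def)
    qed
    then show "resc s (\<gamma> t) \<in> Sympeo"
      using resc_Homeo[OF Homeo[OF t] bd[OF t] s] by (simp add: Sympeo_def)
  next
    show "smooth_into_Ham ({0..1} \<times> {0..1}) (\<lambda>(s, t). \<Lambda>j j s t)" for j
      unfolding \<Lambda>j_def by (rule ham_flow.smooth_into_Ham_resc[OF flows eps'(2,3)])
    show "uniform_limit ({0..1} \<times> {0..1}) (\<lambda>j (s, t). d_bar (\<Lambda>j j s t) (resc s (\<gamma> t))) (\<lambda>_. 0) sequentially"
      unfolding uniform_limit_sequentially_iff
    proof (intro allI impI)
      fix e :: real assume e: "0 < e"
      obtain N where N: "\<forall>j\<ge>N. \<forall>s\<in>{0..1}. \<forall>t\<in>{0..1}. d_bar (\<Lambda>j j s t) (resc s (\<gamma> t)) < e"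
        using unif[OF e] by blast
      show "\<exists>N. \<forall>j\<ge>N. \<forall>z\<in>{0..1} \<times> {0..1}. dist (case z of (s, t) \<Rightarrow> d_bar (\<Lambda>j j s t) (resc s (\<gamma> t))) 0 < e"
        using N d_bar_bounds(1)[OF bijj bijL] by (intro exI[of _ N]) auto
    qed
    show "ham_converges_uniformly_on {0..1} (\<lambda>j s t. \<Lambda>j j s t \<circ> dinv (\<Lambda>j j 0 t))"
      unfolding ham_converges_uniformly_on_def \<Psi>_def[symmetric]
      unfolding smooth_ham_path_def
    proof (intro conjI allI ballI exI[of _ "\<lambda>s t. resc s (\<gamma> t)"] conv\<Psi> pathL)
      show "\<exists>H. generates H (\<Psi> j s)" if "s \<in> {0..1}" for j s using gen[OF that] by blast
    qed (use Cauchy\<Psi> in blast)+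
    show "\<Lambda>j j s 0 x = x" if "s \<in> {0..1}" "x \<in> disc" for j s x
      by (rule ham_flow.flow_0[OF flowj[OF that(1)] that(2)])
  qed (use \<gamma>0 in \<open>auto simp: resc_one intro: resc_identity\<close>)
qed

theorem theorem1p3:
  fixes \<gamma> :: "real \<Rightarrow> real \<times> real \<Rightarrow> real \<times> real"
  assumes "topological_ham_path \<gamma>"
    and "\<forall>x\<in>disc. \<gamma> 0 x = x" and "\<forall>x\<in>disc. \<gamma> 1 x = x"
  shows "\<exists>\<Lambda>. hameotopy (\<lambda>t x. x) \<gamma> \<Lambda> \<and>
    (\<forall>t\<in>{0..1}. \<forall>x\<in>disc. \<Lambda> 0 t x = x \<and> \<Lambda> 1 t x = \<gamma> t x) \<and>
    (\<forall>s\<in>{0..1}. \<forall>x\<in>disc. \<Lambda> s 0 x = x \<and> \<Lambda> s 1 x = x)"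
proof (intro exI conjI)
  show "hameotopy (\<lambda>t x. x) \<gamma> (\<lambda>s t. resc s (\<gamma> t))"
    by (rule hameotopy_Alexander[OF assms(1,2)])
\<comment> \<open>The loop condition at t = 1 enters here: the rescaled identity is the identity at
  every scale.\<close>
qed (use assms(2,3) in \<open>auto simp: resc_one intro: resc_identity\<close>)

end
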